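(* Let $q>2$ be a prime power and let $n,s$ be integers with $1\le s\le n-1$. A function $f:\mathbb F_{q^n}\to\mathbb F_{q^n}$ is $s$th order sum-free if and only if the code $C_s(f)$ (defined in the context) is a $[q^n,k,d]$ code over $\mathbb F_q$ with $$k\ge q^n-n-\dim_{\mathbb F_q}R_q(s(q-1)-1,n)$$ and $$d\ge q^s+(q-2)q^{s-1}.$$
   Context: A function $f:\mathbb F_{q^n}\to\mathbb F_{q^n}$ is called $s$th order sum-free if for every $s$-dimensional $\mathbb F_q$-affine subspace $A$ of $\mathbb F_{q^n}$ one has $\sum_{x\in A}f(x)\neq 0$. Identify $\mathbb F_{q^n}$ with the space of column vectors $\mathbb F_q^n$ via a fixed $\mathbb F_q$-basis, and list its elements as $x_0,\dots,x_{q^n-1}$. Every function $g:\mathbb F_q^n\to\mathbb F_q$ is uniquely represented by a polynomial in $\mathbb F_q[X_1,\dots,X_n]$ of degree at most $q-1$ in each variable; $\deg g$ denotes the total degree of this polynomial. For $-1\le r\le n(q-1)$, the Reed-Muller code is $R_q(r,n)=\{g:\mathbb F_q^n\to\mathbb F_q:\deg g\le r\}$, each $g$ being identified with the vector $(g(x_0),\dots,g(x_{q^n-1}))\in\mathbb F_q^{q^n}$. Let $A_s$ be a generator matrix of $R_q(s(q-1)-1,n)$ (its rows form a basis of this code), with columns indexed by $x_0,\dots,x_{q^n-1}$. For $f:\mathbb F_{q^n}\to\mathbb F_{q^n}$, $C_s(f)$ is the linear code over $\mathbb F_q$ of length $q^n$ with parity check matrix $$\begin{bmatrix} & A_s & \\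 f(x_0)&\cdots&f(x_{q^n-1})\end{bmatrix},$$ where each $f(x_i)$ is regarded as a column vector in $\mathbb F_q^n$; that is, $C_s(f)$ is the set of $u\in\mathbb F_q^{q^n}$ such that this matrix times $u^T$ is $0$. An $[N,k,d]$ code is a linear code of length $N$, dimension $k$ and minimum (Hamming) weight $d$ of nonzero codewords. *)

theory Defs
  imports "HOL-Analysis.Analysis" "HOL-Library.Poly_Mapping" "HOL-Number_Theory.Prime_Powers"
begin

text \<open>
  The field with \<open>q\<close> elements is a finite field type \<open>'k\<close>, the field with \<open>q ^ n\<close> elements is
  a finite field type \<open>'e\<close>, and the inclusion of the former into the latter is a homomorphism
  \<open>h\<close>. The space of column vectors of length \<open>n\<close> is \<open>'k ^ 'n\<close>, and the \<open>q ^ n\<close> columns of a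
  matrix (positions of a codeword) are indexed by a type \<open>'m\<close>.
\<close>

definition field_embedding :: "('k::field \<Rightarrow> 'e::field) \<Rightarrow> bool" where
  "field_embedding h \<longleftrightarrow>
     h 1 = 1 \<and> (\<forall>a b. h (a + b) = h a + h b) \<and> (\<forall>a b. h (a * b) = h a * h b)"

definition ext_scale :: "('k::field \<Rightarrow> 'e::field) \<Rightarrow> 'k \<Rightarrow> 'e \<Rightarrow> 'e" where
  "ext_scale h c y = h c * y"

lemma vector_space_ext_scale:
  assumes "field_embedding h"
  shows "vector_space (ext_scale h)"
  using assms by unfold_locales (auto simp: field_embedding_def ext_scale_def algebra_simps)

definition affine_subspace_of_dim :: "('k::field \<Rightarrow> 'e::field) \<Rightarrow> nat \<Rightarrow> 'e set \<Rightarrow> bool" where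
  "affine_subspace_of_dim h s A \<longleftrightarrow>
     (\<exists>a V. module.subspace (ext_scale h) V \<and> vector_space.dim (ext_scale h) V = s \<and>
            A = (\<lambda>v. a + v) ` V)"

definition sum_free :: "('k::field \<Rightarrow> 'e::field) \<Rightarrow> nat \<Rightarrow> ('e \<Rightarrow> 'e) \<Rightarrow> bool" where
  "sum_free h s f \<longleftrightarrow> (\<forall>A. affine_subspace_of_dim h s A \<longrightarrow> (\<Sum>x\<in>A. f x) \<noteq> 0)"

definition is_basis :: "('k::field \<Rightarrow> 'e::field) \<Rightarrow> ('n \<Rightarrow> 'e) \<Rightarrow> bool" where
  "is_basis h b \<longleftrightarrow> inj b \<and> \<not> module.dependent (ext_scale h) (range b) \<and>
     module.span (ext_scale h) (range b) = UNIV"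

definition coords :: "('k::field \<Rightarrow> 'e::field) \<Rightarrow> ('n::finite \<Rightarrow> 'e) \<Rightarrow> 'e \<Rightarrow> 'k ^ 'n" where
  "coords h b y = (\<chi> i. module.representation (ext_scale h) (range b) y (b i))"

text \<open>
  Polynomials over \<open>'k\<close> in variables indexed by \<open>'n\<close> are finitely supported maps from
  exponent vectors to coefficients.
\<close>

type_synonym ('n, 'k) mvpoly = "('n \<Rightarrow>\<^sub>0 nat) \<Rightarrow>\<^sub>0 'k"

definition mv_eval :: "('n::finite, 'k::field) mvpoly \<Rightarrow> 'k ^ 'n \<Rightarrow> 'k" where
  "mv_eval p v = (\<Sum>m\<in>Poly_Mapping.keys p.
     Poly_Mapping.lookup p m * (\<Prod>i\<in>UNIV. v $ i ^ Poly_Mapping.lookup m i))"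

definition reduced_poly :: "('n, 'k::{field,finite}) mvpoly \<Rightarrow> bool" where
  "reduced_poly p \<longleftrightarrow>
     (\<forall>m\<in>Poly_Mapping.keys p. \<forall>i. Poly_Mapping.lookup m i \<le> CARD('k) - 1)"

lemma exists_delta_poly:
  fixes a :: "'k::{field,finite}"
  obtains p where "degree p \<le> CARD('k) - 1" "\<And>t. poly p t = (if t = a then 1 else 0)"
proof
  let ?p = "\<Prod>c\<in>UNIV - {a}. smult (1 / (a - c)) [:- c, 1:]"
  have "degree ?p \<le> (\<Sum>c\<in>UNIV - {a}. degree (smult (1 / (a - c)) [:- c, 1:]))"
    using degree_prod_sum_le[of "UNIV - {a}" "\<lambda>c. smult (1 / (a - c)) [:- c, 1:]"] by (simp add: o_def)
  also have "\<dots> \<le> (\<Sum>c\<in>UNIV - {a}. 1)"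
    by (intro sum_mono) (auto simp: degree_pCons_eq_if)
  also have "\<dots> = CARD('k) - 1" by (simp add: card_Diff_singleton)
  finally show "degree ?p \<le> CARD('k) - 1" .
  show "poly ?p t = (if t = a then 1 else 0)" for t
  proof (cases "t = a")
    case True
    then show ?thesis by (auto simp: poly_prod simp flip: diff_divide_distrib intro!: prod.neutral)
  next
    case False
    then have "poly ?p t = 0" by (auto simp: poly_prod intro!: prod_zero)
    then show ?thesis using False by simp
  qed
qed

lemma mv_eval_alt:
  assumes "finite E" "Poly_Mapping.keys p \<subseteq> E"
  shows "mv_eval p v = (\<Sum>m\<in>E. Poly_Mapping.lookup p m * (\<Prod>i\<in>UNIV. v $ i ^ Poly_Mapping.lookup m i))"
  unfolding mv_eval_def using assms
  by (intro sum.mono_neutral_left) (auto simp: in_keys_iff)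

lemma bij_lookup_exponents:
  "bij_betw Poly_Mapping.lookup {m :: 'n::finite \<Rightarrow>\<^sub>0 nat. \<forall>i. Poly_Mapping.lookup m i \<le> N}
     (PiE UNIV (\<lambda>_. {..N}))"
  by (rule bij_betw_byWitness[where f' = Abs_poly_mapping])
     (auto simp: PiE_def Pi_def lookup_inverse)

lemma reduced_representation:
  fixes g :: "'k::{field,finite} ^ 'n::finite \<Rightarrow> 'k"
  shows "\<exists>!p. reduced_poly p \<and> mv_eval p = g"
proof -
  define q1 where "q1 = CARD('k) - 1"
  define E where "E = {m :: 'n \<Rightarrow>\<^sub>0 nat. \<forall>i. Poly_Mapping.lookup m i \<le> q1}"
  have bijE: "bij_betw Poly_Mapping.lookup E (PiE UNIV (\<lambda>_. {..q1}))"
    unfolding E_def by (rule bij_lookup_exponents)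
  have finE: "finite E"
    using bij_betw_finite[OF bijE] by (simp add: finite_PiE)
  have "CARD('k) > 0" by simp
  then have "Suc q1 = CARD('k)" by (simp add: q1_def)
  then have cardE: "card E = CARD('k) ^ CARD('n)"
    using bij_betw_same_card[OF bijE] by (simp add: card_PiE)
  define P where "P = {p :: ('n, 'k) mvpoly. reduced_poly p}"
  have P_iff: "p \<in> P \<longleftrightarrow> Poly_Mapping.keys p \<subseteq> E" for p
    by (auto simp: P_def reduced_poly_def E_def q1_def)
  have bijP: "bij_betw (\<lambda>p. restrict (Poly_Mapping.lookup p) E) P (PiE E (\<lambda>_. UNIV))"
  proof (rule bij_betw_byWitness[where f' = "\<lambda>c. Abs_poly_mapping (\<lambda>m. if m \<in> E then c m else 0)"])
    have L: "Poly_Mapping.lookup (Abs_poly_mapping (\<lambda>m. if m \<in> E then c m else (0::'k)))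
        = (\<lambda>m. if m \<in> E then c m else 0)" for c
      by (rule lookup_Abs_poly_mapping) (use finE in \<open>auto intro: finite_subset\<close>)
    show "\<forall>p\<in>P. Abs_poly_mapping (\<lambda>m. if m \<in> E then restrict (Poly_Mapping.lookup p) E m else 0) = p"
      by (auto intro!: poly_mapping_eqI simp: L P_iff in_keys_iff subset_iff)
    show "\<forall>c\<in>PiE E (\<lambda>_. UNIV :: 'k set). restrict (Poly_Mapping.lookup (Abs_poly_mapping (\<lambda>m. if m \<in> E then c m else 0))) E = c"
      by (auto simp: L fun_eq_iff PiE_def extensional_def)
    show "(\<lambda>p. restrict (Poly_Mapping.lookup p) E) ` P \<subseteq> PiE E (\<lambda>_. UNIV)"
      by auto
    show "(\<lambda>c. Abs_poly_mapping (\<lambda>m. if m \<in> E then c m else 0)) ` PiE E (\<lambda>_. UNIV) \<subseteq> P"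
      by (auto simp: P_iff in_keys_iff L split: if_splits)
  qed
  have finP: "finite P"
    using bij_betw_finite[OF bijP] finE by (simp add: finite_PiE)
  have cardP: "card P = CARD('k ^ 'n \<Rightarrow> 'k)"
    using bij_betw_same_card[OF bijP] finE by (simp add: card_PiE cardE card_fun CARD_vec)
  have surj: "\<exists>p\<in>P. mv_eval p = g" for g :: "'k ^ 'n \<Rightarrow> 'k"
  proof -
    have "\<exists>p. degree p \<le> q1 \<and> (\<forall>t. poly p t = (if t = a then 1 else 0))" for a :: 'k
      using exists_delta_poly[of a] unfolding q1_def by metis
    then obtain D where D: "\<And>a. degree (D a) \<le> q1" "\<And>a t. poly (D a) t = (if t = a then 1 else (0::'k))"
      by metis
    have D_sum: "(\<Sum>j\<le>q1. coeff (D a) j * t ^ j) = (if t = a then 1 else 0)" for a t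
    proof -
      have "(\<Sum>j\<le>q1. coeff (D a) j * t ^ j) = (\<Sum>j\<le>degree (D a). coeff (D a) j * t ^ j)"
        using D(1)[of a] by (intro sum.mono_neutral_right) (auto simp: coeff_eq_0)
      then show ?thesis using D(2)[of a t] by (simp add: poly_altdef)
    qed
    define c where "c m = (\<Sum>w\<in>UNIV. g w * (\<Prod>i\<in>UNIV. coeff (D (w $ i)) (Poly_Mapping.lookup m i)))"
      for m :: "'n \<Rightarrow>\<^sub>0 nat"
    define p where "p = Abs_poly_mapping (\<lambda>m. if m \<in> E then c m else 0)"
    have L: "Poly_Mapping.lookup p = (\<lambda>m. if m \<in> E then c m else 0)"
      unfolding p_def by (rule lookup_Abs_poly_mapping) (use finE in \<open>auto intro: finite_subset\<close>)
    have keys: "Poly_Mapping.keys p \<subseteq> E" by (auto simp: in_keys_iff L split: if_splits)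
    have delta: "(\<Sum>m\<in>E. (\<Prod>i\<in>UNIV. coeff (D (w $ i)) (Poly_Mapping.lookup m i) * v $ i ^ Poly_Mapping.lookup m i))
      = (if v = w then 1 else 0)" for v w :: "'k ^ 'n"
    proof -
      have "(\<Sum>m\<in>E. (\<Prod>i\<in>UNIV. coeff (D (w $ i)) (Poly_Mapping.lookup m i) * v $ i ^ Poly_Mapping.lookup m i))
        = (\<Sum>e\<in>PiE UNIV (\<lambda>_. {..q1}). \<Prod>i\<in>UNIV. coeff (D (w $ i)) (e i) * v $ i ^ e i)"
        by (rule sum.reindex_bij_betw[OF bijE])
      also have "\<dots> = (\<Prod>i\<in>UNIV. \<Sum>j\<le>q1. coeff (D (w $ i)) j * v $ i ^ j)"
        by (rule prod_sum_PiE[symmetric]) auto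
      also have "\<dots> = (\<Prod>i\<in>UNIV. if v $ i = w $ i then 1 else 0)"
        by (simp add: D_sum)
      also have "\<dots> = (if v = w then 1 else 0)"
        by (auto simp: vec_eq_iff intro!: prod_zero)
      finally show ?thesis .
    qed
    have "mv_eval p v = g v" for v
    proof -
      have "mv_eval p v = (\<Sum>m\<in>E. \<Sum>w\<in>UNIV. g w *
          (\<Prod>i\<in>UNIV. coeff (D (w $ i)) (Poly_Mapping.lookup m i) * v $ i ^ Poly_Mapping.lookup m i))"
        by (simp add: mv_eval_alt[OF finE keys] L c_def sum_distrib_right prod.distrib mult.assoc)
      also have "\<dots> = (\<Sum>w\<in>UNIV. g w * (\<Sum>m\<in>E.
          (\<Prod>i\<in>UNIV. coeff (D (w $ i)) (Poly_Mapping.lookup m i) * v $ i ^ Poly_Mapping.lookup m i)))"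
        by (subst sum.swap) (simp add: sum_distrib_left)
      also have "\<dots> = g v"
        by (simp add: delta if_distrib cong: if_cong)
      finally show ?thesis .
    qed
    then show ?thesis using keys P_iff by blast
  qed
  have img: "mv_eval ` P = UNIV" using surj by (auto simp: image_iff) metis
  then have "card (mv_eval ` P) = card P" using cardP by simp
  then have "inj_on mv_eval P" using finP by (simp add: eq_card_imp_inj_on)
  then show ?thesis using surj[of g] unfolding P_def inj_on_def by auto
qed

text \<open>The zero polynomial gets degree \<open>-1\<close>, so that the Reed-Muller code of order \<open>-1\<close> is zero.\<close>

definition mv_total_degree :: "('n::finite, 'k::field) mvpoly \<Rightarrow> int" where
  "mv_total_degree p =
     Max (insert (-1) ((\<lambda>m. int (\<Sum>i\<in>UNIV. Poly_Mapping.lookup m i)) ` Poly_Mapping.keys p))"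

definition reduced_rep :: "('k::{field,finite} ^ 'n::finite \<Rightarrow> 'k) \<Rightarrow> ('n, 'k) mvpoly" where
  "reduced_rep g = (THE p. reduced_poly p \<and> mv_eval p = g)"

definition fun_degree :: "('k::{field,finite} ^ 'n::finite \<Rightarrow> 'k) \<Rightarrow> int" where
  "fun_degree g = mv_total_degree (reduced_rep g)"

definition reed_muller :: "int \<Rightarrow> ('k::{field,finite} ^ 'n::finite \<Rightarrow> 'k) set" where
  "reed_muller r = {g. fun_degree g \<le> r}"

text \<open>The Reed-Muller code as a set of words, with respect to a listing \<open>x\<close> of the points.\<close>

definition reed_muller_code :: "('m::finite \<Rightarrow> 'k::{field,finite} ^ 'n::finite) \<Rightarrow> int \<Rightarrow> ('k ^ 'm) set" where
  "reed_muller_code x r = (\<lambda>g. \<chi> j. g (x j)) ` reed_muller r"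

definition generator_matrix :: "'k::field ^ 'm ^ 'r \<Rightarrow> ('k ^ 'm) set \<Rightarrow> bool" where
  "generator_matrix A C \<longleftrightarrow>
     inj (\<lambda>i. row i A) \<and> vec.independent (rows A) \<and> vec.span (rows A) = C"

definition code_of_parity_check :: "'k::field ^ 'm ^ 'r \<Rightarrow> ('k ^ 'm) set" where
  "code_of_parity_check H = {u. H *v u = 0}"

text \<open>
  The parity check matrix with upper block \<open>A\<close> and \<open>j\<close>-th column of the lower block the
  coordinate vector of \<open>f (x j)\<close>.
\<close>

definition parity_check_matrix ::
  "('k::field \<Rightarrow> 'e::field) \<Rightarrow> ('n::finite \<Rightarrow> 'e) \<Rightarrow> ('m::finite \<Rightarrow> 'e) \<Rightarrow>
   'k ^ 'm ^ 'r \<Rightarrow> ('e \<Rightarrow> 'e) \<Rightarrow> 'k ^ 'm ^ ('r::finite + 'n)" where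
  "parity_check_matrix h b x A f =
     (\<chi> i j. case i of Inl a \<Rightarrow> A $ a $ j | Inr c \<Rightarrow> coords h b (f (x j)) $ c)"

definition hamming_weight :: "'k::zero ^ 'm::finite \<Rightarrow> nat" where
  "hamming_weight u = card {j. u $ j \<noteq> 0}"

text \<open>Being an \<open>[N, k, d]\<close> code; this excludes the zero code, which has no minimum weight.\<close>

definition is_code :: "nat \<Rightarrow> nat \<Rightarrow> nat \<Rightarrow> ('k::field ^ 'm::finite) set \<Rightarrow> bool" where
  "is_code N k d C \<longleftrightarrow> CARD('m) = N \<and> vec.subspace C \<and> vec.dim C = k \<and>
     (\<exists>u\<in>C - {0}. hamming_weight u = d) \<and> (\<forall>u\<in>C - {0}. d \<le> hamming_weight u)"

end

theory Submission
  imports Defs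
begin

text \<open>
  A word satisfies the first block of parity checks iff it is orthogonal to all polynomials of
  degree less than \<open>s (q - 1)\<close>; the second block says that the combination of the values of
  \<open>f\<close> with the letters of the word as coefficients is zero. Multiples of indicators of \<open>s\<close>-flats
  are orthogonal to these polynomials and have weight \<open>q ^ s\<close>, so the claim is that every other
  nonzero word orthogonal to them has weight at least \<open>2 (q - 1) q ^ (s - 1)\<close>.

  Let \<open>u\<close> be such a word of smaller weight. Multiplying \<open>u\<close> by factors \<open>l - c\<close> isolates its
  restriction to a hyperplane \<open>l = c\<close>. If the affine form \<open>l\<close> takes between \<open>2\<close> and
  \<open>q - 1\<close> values on the support, counting over the slices gives a contradiction; so every \<open>l\<close> that
  is not constant on the support takes all values there, and one of its slices is small enough to be
  a flat by induction. The moments of \<open>u\<close> along a direction \<open>w\<close> of that flat are again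
  orthogonal to polynomials of bounded degree, and if some moment of order at most \<open>q - 2\<close> is
  nonzero, then the support of \<open>u\<close> is too large; hence \<open>u\<close> is invariant under \<open>w\<close>. Modulo
  these directions the support meets all hyperplanes, and if it spanned more than a line, its image in
  a plane would have at least \<open>2 q - 1\<close> points by Jamison's theorem on blocking sets.
\<close>

section \<open>Power sums and blocking sets over a finite field\<close>

lemma power_card_finite_field:
  fixes t :: "'k::{field,finite}"
  shows "t ^ CARD('k) = t"
proof (cases "t = 0")
  case True
  have "CARD('k) > 0" by simp
  with True show ?thesis by (simp add: zero_power)
next
  case False
  define P where "P = (\<Prod>x\<in>UNIV - {0::'k}. x)"
  have "P \<noteq> 0" by (auto simp: P_def)
  have "P = (\<Prod>x\<in>UNIV - {0}. t * x)"
    unfolding P_def using False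
    by (intro prod.reindex_bij_witness[of _ "\<lambda>x. t * x" "\<lambda>x. x / t"]) auto
  also have "\<dots> = t ^ card (UNIV - {0::'k}) * P"
    unfolding P_def by (subst prod.distrib) simp
  finally have "t ^ (CARD('k) - 1) = 1"
    using \<open>P \<noteq> 0\<close> by (simp add: card_Diff_singleton)
  moreover have "CARD('k) = Suc (CARD('k) - 1)" using zero_less_card_finite[where 'a='k] by linarith
  ultimately show ?thesis by (metis mult_1_right power_Suc)
qed

text \<open>For \<open>j > 0\<close>, scaling by some \<open>g\<close> with
  \<open>g ^ j \<noteq> 1\<close> permutes the field and multiplies the sum by \<open>g ^ j\<close>.
  Such a \<open>g\<close> exists because \<open>X ^ j - 1\<close> has at most \<open>j\<close>
  roots, fewer than there are nonzero elements.\<close>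

lemma sum_power_finite_field:
  assumes "j < CARD('k) - 1"
  shows "(\<Sum>t\<in>(UNIV::'k::{field,finite} set). t ^ j) = 0"
proof (cases "j = 0")
  case True
  \<comment> \<open>As \<open>t ^ 0 = 1\<close> also at \<open>t = 0\<close>, the sum in question is
    the field size read in the field; the translation \<open>t + 1\<close> shows that it is
    zero.\<close>
  have "(\<Sum>t\<in>(UNIV::'k set). t) = (\<Sum>t\<in>UNIV. t + 1)"
    by (rule sum.reindex_bij_witness[of _ "\<lambda>t. t + 1" "\<lambda>t. t - 1"]) auto
  then show ?thesis using True by (simp add: sum.distrib)
next
  case False
  define p :: "'k poly" where "p = monom 1 j - 1"
  have "coeff p j = 1" using False by (simp add: p_def)
  then have "p \<noteq> 0" by auto
  have "degree p \<le> j" unfolding p_def by (intro degree_diff_le) (auto simp: degree_monom_le)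
  then have "card {t. poly p t = 0} \<le> j"
    using card_poly_roots_bound[OF \<open>p \<noteq> 0\<close>] by simp
  then have "\<not> UNIV - {0} \<subseteq> {t. poly p t = 0}"
    using assms card_mono[of "{t. poly p t = 0}" "UNIV - {0}"] by (auto simp: card_Diff_singleton)
  then obtain g where "g \<in> UNIV - {0}" "g \<notin> {t. poly p t = 0}" by blast
  then have g: "g \<noteq> 0" "g ^ j \<noteq> 1" by (auto simp: p_def poly_monom)
  have "(\<Sum>t\<in>(UNIV::'k set). t ^ j) = (\<Sum>t\<in>UNIV. (g * t) ^ j)"
    by (rule sum.reindex_bij_witness[of _ "\<lambda>t. g * t" "\<lambda>t. t / g"]) (use g in auto)
  also have "\<dots> = g ^ j * (\<Sum>t\<in>UNIV. t ^ j)"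
    by (simp add: power_mult_distrib sum_distrib_left)
  finally show ?thesis using g by simp
qed

lemma sum_mult_poly_eq_0:
  fixes g :: "'k::field \<Rightarrow> 'k"
  assumes "\<And>j. j < d \<Longrightarrow> (\<Sum>t\<in>T. g t * t ^ j) = 0" "degree p < d"
  shows "(\<Sum>t\<in>T. g t * poly p t) = 0"
proof -
  have "(\<Sum>t\<in>T. g t * poly p t) = (\<Sum>t\<in>T. \<Sum>i\<le>degree p. coeff p i * (g t * t ^ i))"
    by (simp add: poly_altdef sum_distrib_left mult_ac)
  also have "\<dots> = (\<Sum>i\<le>degree p. coeff p i * (\<Sum>t\<in>T. g t * t ^ i))"
    by (subst sum.swap) (simp add: sum_distrib_left)
  also have "\<dots> = 0" using assms by (intro sum.neutral) auto
  finally show ?thesis .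
qed

text \<open>If the support had at most \<open>d\<close> points, the polynomial vanishing at all of
  them except \<open>a\<close> would have degree below \<open>d\<close>, and pairing it with
  \<open>g\<close> would leave only the nonzero term at \<open>a\<close>.\<close>

lemma card_support_gt_of_vanishing_moments:
  fixes g :: "'k::{field,finite} \<Rightarrow> 'k"
  assumes "\<And>j. j < d \<Longrightarrow> (\<Sum>t\<in>UNIV. g t * t ^ j) = 0" "g a \<noteq> 0"
  shows "d < card {t. g t \<noteq> 0}"
proof (rule ccontr)
  assume "\<not> d < card {t. g t \<noteq> 0}"
  let ?S = "{t. g t \<noteq> 0} - {a}"
  define p where "p = (\<Prod>c\<in>?S. [:- c, 1:])"
  have pos: "card {t. g t \<noteq> 0} > 0" using assms(2) by (auto simp: card_gt_0_iff)
  have "degree p = card ?S"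
    unfolding p_def by (subst degree_prod_eq_sum_degree) auto
  also have "\<dots> = card {t. g t \<noteq> 0} - 1" using assms(2) by (simp add: card_Diff_singleton)
  finally have "degree p < d" using \<open>\<not> d < _\<close> pos by linarith
  have "0 = (\<Sum>t\<in>UNIV. g t * poly p t)"
    using sum_mult_poly_eq_0[OF assms(1) \<open>degree p < d\<close>] by simp
  also have "\<dots> = (\<Sum>t\<in>{a}. g t * poly p t)"
    by (rule sum.mono_neutral_right) (auto simp: p_def poly_prod)
  finally show False using assms(2) by (auto simp: p_def poly_prod)
qed

text \<open>Subtracting the constant \<open>g b\<close> keeps these moments zero, because the power
  sums vanish, and creates a zero at \<open>b\<close>. A nonzero difference would need more support
  points than remain.\<close>

lemma constant_of_vanishing_moments:
  fixes g :: "'k::{field,finite} \<Rightarrow> 'k"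
  assumes "\<And>j. j < CARD('k) - 1 \<Longrightarrow> (\<Sum>t\<in>UNIV. g t * t ^ j) = 0"
  shows "g a = g b"
proof (rule ccontr)
  assume "g a \<noteq> g b"
  have "CARD('k) - 1 < card {t. g t - g b \<noteq> 0}"
  proof (rule card_support_gt_of_vanishing_moments)
    show "(\<Sum>t\<in>UNIV. (g t - g b) * t ^ j) = 0" if "j < CARD('k) - 1" for j
      using assms[OF that] sum_power_finite_field[OF that]
      by (simp add: left_diff_distrib sum_subtractf flip: sum_distrib_left)
    show "g a - g b \<noteq> 0" using \<open>g a \<noteq> g b\<close> by simp
  qed
  moreover have "{t. g t - g b \<noteq> 0} \<subseteq> UNIV - {b}" by auto
  then have "card {t. g t - g b \<noteq> 0} \<le> CARD('k) - 1"
    using card_mono[of "UNIV - {b}" "{t. g t - g b \<noteq> 0}"] by (simp add: card_Diff_singleton)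
  ultimately show False by simp
qed

section \<open>Blocking sets in the affine plane\<close>

text \<open>A Chevalley-Warning argument: expanding one factor raises \<open>i + j\<close> by at
  most one while \<open>B\<close> loses a point. Once \<open>B\<close> is empty, the double sum is a
  product of two power sums, one of them with exponent below \<open>CARD('k) - 1\<close>.\<close>

lemma sum_prod_affine_plane:
  fixes z :: "'k::{field,finite} \<times> 'k \<Rightarrow> 'k"
  assumes "finite B" "i + j + card B < 2 * (CARD('k) - 1)"
  shows "(\<Sum>a\<in>UNIV. \<Sum>b\<in>UNIV. a ^ i * b ^ j * (\<Prod>y\<in>B. a * fst y + b * snd y + z y)) = 0"
  using assms
proof (induction B arbitrary: i j rule: finite_induct)
  case empty
  then have "i < CARD('k) - 1 \<or> j < CARD('k) - 1" by auto
  then have "(\<Sum>a\<in>(UNIV::'k set). a ^ i) * (\<Sum>b\<in>(UNIV::'k set). b ^ j) = 0"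
    using sum_power_finite_field[where 'k='k] by auto
  then show ?case by (simp add: sum_product)
next
  case (insert y B)
  let ?P = "\<lambda>i j a b. a ^ i * b ^ j * (\<Prod>y\<in>B. a * fst y + b * snd y + z y)"
  have "(\<Sum>a\<in>UNIV. \<Sum>b\<in>UNIV. a ^ i * b ^ j * (\<Prod>y\<in>insert y B. a * fst y + b * snd y + z y))
     = (\<Sum>a\<in>UNIV. \<Sum>b\<in>UNIV. fst y * ?P (Suc i) j a b + snd y * ?P i (Suc j) a b + z y * ?P i j a b)"
    using insert.hyps by (simp add: algebra_simps)
  also have "\<dots> = fst y * (\<Sum>a\<in>UNIV. \<Sum>b\<in>UNIV. ?P (Suc i) j a b)
      + snd y * (\<Sum>a\<in>UNIV. \<Sum>b\<in>UNIV. ?P i (Suc j) a b) + z y * (\<Sum>a\<in>UNIV. \<Sum>b\<in>UNIV. ?P i j a b)"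
    by (simp only: sum.distrib sum_distrib_left)
  also have "\<dots> = 0"
    using insert.prems insert.hyps
    by (subst insert.IH, simp, subst insert.IH, simp, subst insert.IH, simp_all)
  finally show ?case .
qed

text \<open>Jamison's argument: after moving a point of \<open>B\<close> to the origin, the function
  \<open>(a, b) \<mapsto> \<Prod>y. a y\<^sub>1 + b y\<^sub>2 - 1\<close>, over the other points \<open>y\<close> of \<open>B\<close>, vanishes
  everywhere except at \<open>(0, 0)\<close>.\<close>

lemma card_affine_blocking_set_plane:
  fixes B :: "('k::{field,finite} \<times> 'k) set"
  assumes blocking: "\<And>a b c. (a, b) \<noteq> (0, 0) \<Longrightarrow> \<exists>y\<in>B. a * fst y + b * snd y = c"
  shows "2 * CARD('k) - 1 \<le> card B"
proof (rule ccontr)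
  assume small: "\<not> 2 * CARD('k) - 1 \<le> card B"
  obtain o1 o2 where o: "(o1, o2) \<in> B" using blocking[of 1 0 0] by auto
  define C where "C = B - {(o1, o2)}"
  define z where "z = (\<lambda>y::'k \<times> 'k. - 1 :: 'k)"
  define D where "D = (\<lambda>y. (fst y - o1, snd y - o2)) ` C"
  have "card D \<le> card C" unfolding D_def by (simp add: card_image_le)
  also have "\<dots> = card B - 1" unfolding C_def using o by (simp add: card_Diff_singleton)
  finally have "card D \<le> card B - 1" .
  moreover have "card B > 0" using o by (auto simp: card_gt_0_iff)
  ultimately have "card D < 2 * (CARD('k) - 1)" using small by linarith
  then have "0 = (\<Sum>a\<in>UNIV. \<Sum>b\<in>UNIV. \<Prod>y\<in>D. a * fst y + b * snd y + z y)"
    using sum_prod_affine_plane[of D 0 0 z] by simp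
  also have "\<dots> = (\<Sum>(a, b)\<in>UNIV. \<Prod>y\<in>D. a * fst y + b * snd y + z y)"
    by (simp add: sum.cartesian_product)
  also have "\<dots> = (\<Sum>(a, b)\<in>{(0, 0)}. \<Prod>y\<in>D. a * fst y + b * snd y + z y)"
  proof (rule sum.mono_neutral_right)
    have vanish: "(\<Prod>y\<in>D. a * fst y + b * snd y + z y) = 0" if "(a, b) \<noteq> (0, 0)" for a b
    proof -
      \<comment> \<open>The constant exceeds the value at \<open>(o1, o2)\<close> by 1. Hence the
        point found on this line is not \<open>(o1, o2)\<close>, and its translate in
        \<open>D\<close> makes a factor zero.\<close>
      from blocking[OF that, of "a * o1 + b * o2 + 1"]
      obtain y where y: "y \<in> B" "a * fst y + b * snd y = a * o1 + b * o2 + 1" by auto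
      then have "y \<in> C" unfolding C_def by auto
      then have "(fst y - o1, snd y - o2) \<in> D" unfolding D_def by blast
      moreover have "a * (fst y - o1) + b * (snd y - o2) - 1 = 0"
        using y(2) by (simp add: algebra_simps)
      ultimately show ?thesis
        unfolding z_def by (intro prod_zero) (auto intro!: bexI[of _ "(fst y - o1, snd y - o2)"])
    qed
    show "\<forall>p\<in>UNIV - {(0, 0)}. (case p of (a, b) \<Rightarrow> \<Prod>y\<in>D. a * fst y + b * snd y + z y) = 0"
    proof
      fix p :: "'k \<times> 'k" assume "p \<in> UNIV - {(0, 0)}"
      then show "(case p of (a, b) \<Rightarrow> \<Prod>y\<in>D. a * fst y + b * snd y + z y) = 0"
        using vanish[of "fst p" "snd p"] by (simp add: case_prod_beta prod_eq_iff)
    qed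
  qed auto
  also have "\<dots> \<noteq> 0" by (simp add: z_def)
  finally show False by simp
qed

section \<open>Words orthogonal to polynomials of small degree\<close>

lemma card_eq_sum_fibres:
  assumes "finite S" "finite T" "g ` S \<subseteq> T"
  shows "card S = (\<Sum>y\<in>T. card {x\<in>S. g x = y})"
  using sum.group[OF assms, of "\<lambda>_. 1::nat"] by simp

text \<open>The scaling is a parameter because the locale serves twice: for the extension field with
  \<open>ext_scale h\<close>, and for the space \<open>'k ^ 'm\<close> of words.\<close>

locale finite_linear_space = vector_space scale
  for scale :: "'k::{field,finite} \<Rightarrow> 'v::{ab_group_add,finite} \<Rightarrow> 'v" +
  fixes q :: nat
  assumes q_eq: "q = CARD('k)"
begin

lemma q_ge_2: "2 \<le> q"
  using card_mono[of UNIV "{0, 1::'k}"] by (simp add: q_eq)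

definition lform :: "('v \<Rightarrow> 'k) \<Rightarrow> bool" where
  "lform f \<longleftrightarrow> (\<forall>x y. f (x + y) = f x + f y) \<and> (\<forall>c x. f (scale c x) = c * f x)"

definition aform :: "('v \<Rightarrow> 'k) \<Rightarrow> bool" where
  "aform f \<longleftrightarrow> (\<exists>g c. lform g \<and> f = (\<lambda>x. g x + c))"

definition prod_forms :: "('v \<Rightarrow> 'k) list \<Rightarrow> 'v \<Rightarrow> 'k" where
  "prod_forms fs x = prod_list (map (\<lambda>f. f x) fs)"

text \<open>Every polynomial of degree less than \<open>r\<close> is a linear combination of products of fewer than \<open>r\<close>
  affine forms, so \<open>dual r\<close> consists of the words orthogonal to all of these polynomials.\<close>

definition dual :: "nat \<Rightarrow> ('v \<Rightarrow> 'k) set" where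
  "dual r = {u. \<forall>fs. list_all aform fs \<longrightarrow> length fs < r \<longrightarrow> (\<Sum>x\<in>UNIV. u x * prod_forms fs x) = 0}"

definition supp :: "('v \<Rightarrow> 'k) \<Rightarrow> 'v set" where
  "supp u = {x. u x \<noteq> 0}"

definition slice :: "('v \<Rightarrow> 'k) \<Rightarrow> 'k \<Rightarrow> ('v \<Rightarrow> 'k) \<Rightarrow> 'v \<Rightarrow> 'k" where
  "slice l c u x = (if l x = c then u x else 0)"

lemma lform_add: "lform f \<Longrightarrow> f (x + y) = f x + f y"
  and lform_scale: "lform f \<Longrightarrow> f (scale c x) = c * f x"
  by (auto simp: lform_def)

lemma lform_0: "lform f \<Longrightarrow> f 0 = 0"
  using lform_scale[of f 0 0] by simp

lemma lform_diff: "lform f \<Longrightarrow> f (x - y) = f x - f y"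
  using lform_add[of f "x - y" y] by (simp add: algebra_simps)

lemma lform_combination: "lform f \<Longrightarrow> lform g \<Longrightarrow> lform (\<lambda>x. a * f x + b * g x)"
  by (auto simp: lform_def algebra_simps)

lemma lform_sum: "(\<And>i. i \<in> I \<Longrightarrow> lform (f i)) \<Longrightarrow> lform (\<lambda>x. \<Sum>i\<in>I. a i * f i x)"
  by (auto simp: lform_def algebra_simps sum.distrib sum_distrib_left intro!: sum.cong)

lemma aform_lform: "lform f \<Longrightarrow> aform (\<lambda>x. f x + c)"
  by (auto simp: aform_def)

lemma lform_imp_aform: "lform f \<Longrightarrow> aform f"
  using aform_lform[of f 0] by simp

lemma aform_lform_diff: "lform f \<Longrightarrow> aform (\<lambda>x. f x - c)"
  using aform_lform[of f "- c"] by simp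

lemma prod_forms_simps [simp]:
  "prod_forms [] x = 1"
  "prod_forms (f # fs) x = f x * prod_forms fs x"
  "prod_forms (fs @ gs) x = prod_forms fs x * prod_forms gs x"
  "prod_forms (replicate d f) x = f x ^ d"
  by (simp_all add: prod_forms_def prod_list_replicate)

lemma dualD: "u \<in> dual r \<Longrightarrow> list_all aform fs \<Longrightarrow> length fs < r \<Longrightarrow> (\<Sum>x\<in>UNIV. u x * prod_forms fs x) = 0"
  by (simp add: dual_def)

lemma dualI:
  "(\<And>fs. list_all aform fs \<Longrightarrow> length fs < r \<Longrightarrow> (\<Sum>x\<in>UNIV. u x * prod_forms fs x) = 0) \<Longrightarrow> u \<in> dual r"
  by (simp add: dual_def)

lemma dual_antimono: "r \<le> r' \<Longrightarrow> u \<in> dual r' \<Longrightarrow> u \<in> dual r"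
  by (auto simp: dual_def)

lemma dual_cmult: "u \<in> dual r \<Longrightarrow> (\<lambda>x. c * u x) \<in> dual r"
  by (auto simp: dual_def mult.assoc simp flip: sum_distrib_left)

lemma dual_diff: "u \<in> dual r \<Longrightarrow> v \<in> dual r \<Longrightarrow> (\<lambda>x. u x - v x) \<in> dual r"
  by (auto simp: dual_def left_diff_distrib sum_subtractf)

lemma dual_mult: "u \<in> dual r \<Longrightarrow> aform f \<Longrightarrow> (\<lambda>x. u x * f x) \<in> dual (r - 1)"
  using dualD[of u r "f # _"] by (intro dualI) (auto simp: mult_ac)

lemma dual_mult_power: "u \<in> dual r \<Longrightarrow> aform f \<Longrightarrow> (\<lambda>x. u x * f x ^ m) \<in> dual (r - m)"
proof (induction m)
  case (Suc m)
  then show ?case using dual_mult[of "\<lambda>x. u x * f x ^ m" "r - m" f] by (simp add: mult_ac)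
qed simp

lemma dual_mult_prod:
  assumes "finite I" "\<And>i. i \<in> I \<Longrightarrow> aform (f i)" "u \<in> dual r"
  shows "(\<lambda>x. u x * (\<Prod>i\<in>I. f i x ^ m i)) \<in> dual (r - (\<Sum>i\<in>I. m i))"
  using assms
proof (induction I rule: finite_induct)
  case (insert i I)
  then show ?case
    using dual_mult_power[of "\<lambda>x. u x * (\<Prod>i\<in>I. f i x ^ m i)" "r - (\<Sum>i\<in>I. m i)" "f i" "m i"]
    by (simp add: mult_ac add.commute)
qed simp

text \<open>Multiplying by \<open>l - d\<close> for every other value \<open>d\<close> on the
  support kills the other slices and scales this one by a nonzero constant. Each factor costs one
  degree, and only values attained on the support need a factor.\<close>

lemma slice_in_dual:
  assumes "u \<in> dual r" "lform l" "c \<in> l ` supp u"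
  shows "slice l c u \<in> dual (r - (card (l ` supp u) - 1))"
proof -
  define C where "C = l ` supp u - {c}"
  have "card C = card (l ` supp u) - 1" using assms(3) by (simp add: C_def card_Diff_singleton)
  moreover have "(\<lambda>x. u x * (\<Prod>d\<in>C. (l x - d) ^ 1)) \<in> dual (r - (\<Sum>d\<in>C. 1))"
    by (rule dual_mult_prod) (auto simp: assms aform_lform_diff)
  ultimately have *: "(\<lambda>x. u x * (\<Prod>d\<in>C. l x - d)) \<in> dual (r - (card (l ` supp u) - 1))" by simp
  define K where "K = (\<Prod>d\<in>C. c - d)"
  have "K \<noteq> 0" by (auto simp: K_def C_def)
  have "u x * (\<Prod>d\<in>C. l x - d) = K * slice l c u x" for x
  proof (cases "l x = c \<or> u x = 0")
    case True
    then show ?thesis by (auto simp: slice_def K_def)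
  next
    case False
    then have "l x \<in> C" by (auto simp: C_def supp_def)
    then have "(\<Prod>d\<in>C. l x - d) = 0" by (intro prod_zero) auto
    then show ?thesis using False by (simp add: slice_def)
  qed
  then have "(\<lambda>x. K * slice l c u x) \<in> dual (r - (card (l ` supp u) - 1))" using * by simp
  from dual_cmult[OF this, of "1 / K"] show ?thesis using \<open>K \<noteq> 0\<close> by (simp add: mult.assoc[symmetric])
qed

lemma supp_slice: "supp (slice l c u) = {x \<in> supp u. l x = c}"
  by (auto simp: supp_def slice_def)

lemma card_supp_slices: "l ` supp u \<subseteq> C \<Longrightarrow> card (supp u) = (\<Sum>c\<in>C. card (supp (slice l c u)))"
  unfolding supp_slice by (intro card_eq_sum_fibres) auto

lemma lform_separating:
  assumes "subspace U" "v \<notin> U"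
  obtains f where "lform f" "\<And>x. x \<in> U \<Longrightarrow> f x = 0" "f v = 1"
proof -
  interpret vp: vector_space_pair scale "(*) :: 'k \<Rightarrow> 'k \<Rightarrow> 'k" ..
  obtain B where B: "B \<subseteq> U" "independent B" "U \<subseteq> span B" using basis_exists by metis
  have "span B = U" using B assms(1) by (simp add: span_minimal subset_antisym)
  then have "v \<notin> span B" using assms(2) by simp
  then have "v \<notin> B" "independent (insert v B)" using B(2) span_base by (auto simp: independent_insert)
  then obtain g where g: "Vector_Spaces.linear scale (*) g"
    "\<And>x. x \<in> insert v B \<Longrightarrow> g x = (if x = v then 1 else 0)"
    using vp.linear_independent_extend[of "insert v B" "\<lambda>x. if x = v then 1 else 0"] by metis
  have "lform g" using vp.linear_add[OF g(1)] vp.linear_scale[OF g(1)] by (simp add: lform_def)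
  moreover have "g x = 0" if "x \<in> U" for x
  proof (rule vp.linear_eq_0_on_span[OF g(1)])
    show "x \<in> span B" using that \<open>span B = U\<close> by simp
    show "g y = 0" if "y \<in> B" for y using g(2)[of y] that \<open>v \<notin> B\<close> by auto
  qed
  moreover have "g v = 1" using g(2) by simp
  ultimately show ?thesis using that by blast
qed

lemma lform_separating_points:
  assumes "x \<noteq> y"
  obtains f where "lform f" "f x \<noteq> f y"
proof -
  obtain f where "lform f" "f (x - y) = 1"
    using lform_separating[of "{0}" "x - y"] assms by (auto simp: subspace_def)
  then have "f x \<noteq> f y" by (auto simp: lform_diff)
  then show ?thesis using that \<open>lform f\<close> by blast
qed

section \<open>Minimum weight of words orthogonal to small degree\<close>

text \<open>For \<open>r = a (q - 1) + b\<close> with \<open>b < q - 1\<close> this is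
  \<open>(b + 1) q ^ a\<close>, the classical minimum distance of the generalized Reed-Muller code
  dual to the polynomials of degree less than \<open>r\<close>.\<close>

definition min_weight :: "nat \<Rightarrow> nat" where
  "min_weight r = (r mod (q - 1) + 1) * q ^ (r div (q - 1))"

lemma min_weight_eq: "b < q - 1 \<Longrightarrow> min_weight (a * (q - 1) + b) = (b + 1) * q ^ a"
  by (simp add: min_weight_def)

text \<open>The arithmetic for adding up slices: a form with \<open>J\<close> values on the support
  gives \<open>J\<close> slices, each in a dual of order lower by \<open>J - 1\<close>.\<close>

lemma min_weight_step:
  assumes "1 \<le> J" "J \<le> q"
  shows "min_weight r \<le> J * min_weight (r - (J - 1))"
proof -
  define a b k where "a = r div (q - 1)" and "b = r mod (q - 1)" and "k = J - 1"
  have r: "r = a * (q - 1) + b" unfolding a_def b_def by (rule div_mult_mod_eq[symmetric])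
  have b: "b < q - 1" using q_ge_2 by (simp add: b_def)
  have J: "J = k + 1" "k \<le> q - 1" using assms by (auto simp: k_def)
  show ?thesis
  proof (cases "k \<le> b")
    case True
    then obtain c where c: "b = k + c" using le_Suc_ex by blast
    have "r - (J - 1) = a * (q - 1) + c" using J r c by simp
    moreover have "b + 1 \<le> (k + 1) * (c + 1)" by (simp add: c)
    then have "(b + 1) * q ^ a \<le> (k + 1) * ((c + 1) * q ^ a)"
      unfolding mult.assoc[symmetric] by (rule mult_right_mono) simp
    moreover have "min_weight r = (b + 1) * q ^ a" using b by (simp only: r min_weight_eq)
    moreover have "min_weight (a * (q - 1) + c) = (c + 1) * q ^ a"
      using b c by (simp only: min_weight_eq)
    ultimately show ?thesis using J by simp
  next
    case False
    then obtain c where c: "k = b + c" "c > 0" using less_imp_add_positive not_le by blast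
    show ?thesis
    proof (cases a)
      \<comment> \<open>Truncated subtraction gives order 0 and a bound of only 1 per slice, which
        suffices because \<open>J\<close> exceeds \<open>b\<close>.\<close>
      case 0
      then have "min_weight r = b + 1" "min_weight (r - (J - 1)) = 1"
        using r b J c min_weight_eq[of b 0] min_weight_eq[of 0 0] by auto
      then show ?thesis using J c by simp
    next
      case (Suc a')
      \<comment> \<open>Subtracting \<open>J - 1\<close> borrows \<open>q - 1\<close> from the
        quotient part; \<open>b + e\<close> is the new remainder.\<close>
      define e where "e = q - 1 - (b + c)"
      have e: "q = b + c + e + 1" using J c q_ge_2 unfolding e_def by linarith
      have eq: "r - (J - 1) = a' * (q - 1) + (b + e)" using Suc r J c e by simp
      have "(b + 1) * q \<le> (b + c + 1) * (b + e + 1)" by (simp add: e algebra_simps)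
      then have "(b + 1) * q * q ^ a' \<le> (b + c + 1) * (b + e + 1) * q ^ a'" by (rule mult_right_mono) simp
      moreover have "min_weight r = (b + 1) * q * q ^ a'" using b Suc by (simp only: r min_weight_eq power_Suc mult.assoc)
      moreover have "min_weight (r - (J - 1)) = (b + e + 1) * q ^ a'"
        unfolding eq by (subst min_weight_eq) (use e c in auto)
      moreover have "J = b + c + 1" using J c by simp
      ultimately show ?thesis by (simp only: mult.assoc)
    qed
  qed
qed

lemma card_supp_ge_of_slices:
  assumes "\<And>c. c \<in> l ` supp u \<Longrightarrow> m \<le> card (supp (slice l c u))"
  shows "card (l ` supp u) * m \<le> card (supp u)"
  using sum_mono[of "l ` supp u" "\<lambda>_. m" "\<lambda>c. card (supp (slice l c u))"] assms
  by (simp add: card_supp_slices[of l u "l ` supp u"])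

text \<open>A form separating two support points makes every slice strictly smaller, so induction
  applies to the slices and \<open>min_weight_step\<close> adds them up. A one-point support is
  possible only for \<open>r = 0\<close>, since the constant 1 detects it.\<close>

lemma min_weight_le_card_supp:
  assumes "u \<in> dual r" "p \<in> supp u"
  shows "min_weight r \<le> card (supp u)"
  using assms
proof (induction "card (supp u)" arbitrary: u p r rule: less_induct)
  case less
  show ?case
  proof (cases "supp u = {p}")
    case True
    have "r = 0"
    proof (rule ccontr)
      assume "r \<noteq> 0"
      then have "0 = (\<Sum>x\<in>UNIV. u x)" using dualD[OF less.prems(1), of "[]"] by simp
      also have "\<dots> = (\<Sum>x\<in>supp u. u x)" by (rule sum.mono_neutral_right) (auto simp: supp_def)
      finally have "u p = 0" using True by simp
      then show False using less.prems(2) by (simp add: supp_def)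
    qed
    then show ?thesis using True by (simp add: min_weight_def)
  next
    case False
    then obtain p' where p': "p' \<in> supp u" "p' \<noteq> p" using less.prems(2) by blast
    then obtain l where l: "lform l" "l p' \<noteq> l p" using lform_separating_points by metis
    have "card {l p, l p'} \<le> card (l ` supp u)" using p' less.prems(2) by (intro card_mono) auto
    then have J: "2 \<le> card (l ` supp u)" using l(2) by auto
    have Jq: "card (l ` supp u) \<le> q" unfolding q_eq by (rule card_mono) auto
    let ?m = "min_weight (r - (card (l ` supp u) - 1))"
    have "?m \<le> card (supp (slice l c u))" if "c \<in> l ` supp u" for c
    proof -
      obtain x where x: "x \<in> supp (slice l c u)" using \<open>c \<in> l ` supp u\<close> unfolding supp_slice by blast
      have "supp (slice l c u) \<noteq> supp u" using l(2) p' less.prems(2) unfolding supp_slice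
        by (metis (mono_tags, lifting) mem_Collect_eq)
      then have "card (supp (slice l c u)) < card (supp u)"
        by (intro psubset_card_mono) (auto simp: supp_slice)
      from less.hyps[OF this slice_in_dual[OF less.prems(1) l(1) that] x] show ?thesis .
    qed
    then have "card (l ` supp u) * ?m \<le> card (supp u)" by (rule card_supp_ge_of_slices)
    then show ?thesis using min_weight_step[of "card (l ` supp u)" r] J Jq by linarith
  qed
qed

lemma card_supp_slices_ge:
  assumes "u \<in> dual r" "lform l" "c \<in> l ` supp u"
  shows "min_weight (r - (card (l ` supp u) - 1)) \<le> card (supp (slice l c u))"
proof -
  obtain x where "x \<in> supp (slice l c u)" using assms unfolding supp_slice by blast
  then show ?thesis using min_weight_le_card_supp[OF slice_in_dual[OF assms]] by blast
qed

text \<open>With \<open>J = i + 2\<close> values and \<open>q = i + k + 3\<close>, each slice weighs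
  at least \<open>(k + 2) q ^ s\<close>, and
  \<open>(i + 2) (k + 2) \<ge> 2 (i + k + 2) = 2 (q - 1)\<close>.\<close>

lemma card_supp_ge_of_missed_value:
  assumes "u \<in> dual (Suc s * (q - 1))" "lform l" "2 \<le> card (l ` supp u)" "card (l ` supp u) \<le> q - 1"
  shows "2 * (q - 1) * q ^ s \<le> card (supp u)"
proof -
  define J where "J = card (l ` supp u)"
  define i k where "i = J - 2" and "k = q - 1 - J"
  have ik: "J = i + 2" "q = i + 2 + k + 1"
    using assms(3,4) q_ge_2 unfolding J_def[symmetric] i_def k_def by linarith+
  have "Suc s * (q - 1) - (J - 1) = s * (q - 1) + (k + 1)" using ik by simp
  moreover have "k + 1 < q - 1" using ik by linarith
  moreover have "k + 1 + 1 = k + 2" by simp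
  ultimately have "min_weight (Suc s * (q - 1) - (J - 1)) = (k + 2) * q ^ s"
    by (simp only: min_weight_eq)
  then have "J * ((k + 2) * q ^ s) \<le> card (supp u)"
    using card_supp_ge_of_slices[of l u "(k + 2) * q ^ s"] card_supp_slices_ge[OF assms(1,2)]
    unfolding J_def[symmetric] by simp
  moreover have "2 * (q - 1) \<le> J * (k + 2)" using ik by simp
  then have "2 * (q - 1) * q ^ s \<le> J * (k + 2) * q ^ s" by (rule mult_right_mono) simp
  ultimately show ?thesis unfolding mult.assoc by linarith
qed

section \<open>Cardinality of subspaces and indicators of flats\<close>

lemma bij_betw_span_insert:
  assumes "v \<notin> span B"
  shows "bij_betw (\<lambda>(x, t). x + scale t v) (span B \<times> UNIV) (span (insert v B))"
proof (rule bij_betwI')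
  fix a b :: "'v \<times> 'k" assume ab: "a \<in> span B \<times> UNIV" "b \<in> span B \<times> UNIV"
  obtain x t y r where [simp]: "a = (x, t)" "b = (y, r)" by (cases a, cases b)
  have "x = y \<and> t = r" if eq: "x + scale t v = y + scale r v"
  proof -
    have eq': "scale (t - r) v = y - x" using eq by (simp add: algebra_simps)
    have "y - x \<in> span B" using ab by (simp add: span_diff)
    then have "scale (1 / (t - r)) (scale (t - r) v) \<in> span B"
      unfolding eq' by (rule span_scale)
    then have "t = r" using assms by (cases "t = r") auto
    then show ?thesis using eq by simp
  qed
  then show "((case a of (x, t) \<Rightarrow> x + scale t v) = (case b of (x, t) \<Rightarrow> x + scale t v)) = (a = b)"
    by auto
next
  fix a :: "'v \<times> 'k" assume "a \<in> span B \<times> UNIV"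
  then show "(case a of (x, t) \<Rightarrow> x + scale t v) \<in> span (insert v B)"
    by (auto simp: span_breakdown_eq intro!: exI[of _ "snd a"])
next
  fix y assume "y \<in> span (insert v B)"
  then obtain k where "y - scale k v \<in> span B" by (auto simp: span_breakdown_eq)
  then show "\<exists>a\<in>span B \<times> UNIV. y = (case a of (x, t) \<Rightarrow> x + scale t v)"
    by (intro bexI[of _ "(y - scale k v, k)"]) auto
qed

lemma card_span_insert: "v \<notin> span B \<Longrightarrow> card (span (insert v B)) = q * card (span B)"
  using bij_betw_same_card[OF bij_betw_span_insert[of v B]] by (simp add: card_cartesian_product q_eq mult.commute)

lemma card_span_independent:
  assumes "independent B"
  shows "card (span B) = q ^ card B"
proof -
  have "finite B" by simp
  then show ?thesis using assms
  proof (induction B rule: finite_induct)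
    case (insert v B)
    then have "v \<notin> span B" "independent B" by (auto simp: independent_insert)
    then show ?case using insert by (simp add: card_span_insert)
  qed simp
qed

lemma card_subspace:
  assumes "subspace U"
  shows "card U = q ^ dim U"
proof -
  obtain B where B: "B \<subseteq> U" "independent B" "U \<subseteq> span B" "card B = dim U" using basis_exists by metis
  have "span B = U" using B assms by (simp add: span_minimal subset_antisym)
  then show ?thesis using card_span_independent[OF B(2)] B(4) by simp
qed

lemma aform_add:
  assumes "aform f"
  obtains g where "\<And>x y. f (x + y) = f x + g y" "\<And>c y. g (scale c y) = c * g y"
proof -
  obtain g c where "lform g" "f = (\<lambda>x. g x + c)" using assms by (auto simp: aform_def)
  then show ?thesis using that[of g] by (auto simp: lform_def)
qed

lemma aform_translate:
  assumes "aform f"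
  shows "aform (\<lambda>x. f (x + p))"
proof -
  obtain g c where g: "lform g" "f = (\<lambda>x. g x + c)" using assms by (auto simp: aform_def)
  then have "(\<lambda>x. f (x + p)) = (\<lambda>x. g x + (g p + c))" by (auto simp: lform_add)
  then show ?thesis using aform_lform[OF g(1)] by simp
qed

text \<open>Each factor \<open>f (x + t v) = f x + t g v\<close>, with \<open>g\<close> the linear
  part of \<open>f\<close>, moves either to the list \<open>gs\<close> of factors in
  \<open>x\<close> alone or to the power of \<open>t\<close>. Finally the sum splits into one over
  \<open>T\<close> and a power sum in \<open>t\<close>, and the degree bound forces one of them to
  vanish.\<close>

lemma sum_prod_forms_line:
  assumes IH: "\<And>gs. list_all aform gs \<Longrightarrow> length gs < m \<Longrightarrow> (\<Sum>x\<in>T. prod_forms gs x) = 0"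
    and "list_all aform fs" "list_all aform gs" "length fs + length gs + j < m + (q - 1)"
  shows "(\<Sum>x\<in>T. \<Sum>t\<in>UNIV. t ^ j * prod_forms gs x * prod_forms fs (x + scale t v)) = 0"
  using assms(2-)
proof (induction fs arbitrary: gs j)
  case Nil
  have "(\<Sum>x\<in>T. prod_forms gs x) * (\<Sum>t\<in>UNIV. t ^ j) = 0"
  proof (cases "j < q - 1")
    case True
    then show ?thesis using sum_power_finite_field[where 'k='k] by (simp add: q_eq)
  next
    case False
    then show ?thesis using Nil IH by simp
  qed
  then show ?case by (simp add: sum_product mult_ac)
next
  case (Cons f fs)
  then have "aform f" by simp
  then obtain g where g: "\<And>x y. f (x + y) = f x + g y" "\<And>c y. g (scale c y) = c * g y"
    using aform_add by metis
  let ?S = "\<lambda>gs j. \<Sum>x\<in>T. \<Sum>t\<in>UNIV. t ^ j * prod_forms gs x * prod_forms fs (x + scale t v)"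
  have "(\<Sum>x\<in>T. \<Sum>t\<in>UNIV. t ^ j * prod_forms gs x * prod_forms (f # fs) (x + scale t v)) =
     (\<Sum>x\<in>T. \<Sum>t\<in>UNIV. t ^ j * prod_forms (f # gs) x * prod_forms fs (x + scale t v) +
       g v * (t ^ Suc j * prod_forms gs x * prod_forms fs (x + scale t v)))"
    by (simp add: g algebra_simps)
  also have "\<dots> = ?S (f # gs) j + g v * ?S gs (Suc j)"
    by (simp only: sum.distrib sum_distrib_left)
  also have "?S (f # gs) j = 0" using Cons.prems by (intro Cons.IH) auto
  also have "?S gs (Suc j) = 0" using Cons.prems by (intro Cons.IH) auto
  finally show ?case by simp
qed

text \<open>Every further basis vector raises the annihilated degree by \<open>q - 1\<close>, by
  \<open>sum_prod_forms_line\<close> with \<open>gs\<close> empty and \<open>j = 0\<close>.\<close>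

lemma sum_prod_forms_span:
  assumes "independent B" "list_all aform fs" "length fs < card B * (q - 1)"
  shows "(\<Sum>x\<in>span B. prod_forms fs x) = 0"
proof -
  have "finite B" by simp
  then show ?thesis using assms
  proof (induction B arbitrary: fs rule: finite_induct)
    case (insert v B)
    then have v: "v \<notin> span B" "independent B" by (auto simp: independent_insert)
    have "(\<Sum>x\<in>span (insert v B). prod_forms fs x) =
        (\<Sum>(x, t)\<in>span B \<times> UNIV. prod_forms fs (x + scale t v))"
      by (rule sum.reindex_bij_betw[OF bij_betw_span_insert[OF v(1)], symmetric, THEN trans])
        (simp add: case_prod_beta)
    also have "\<dots> = (\<Sum>x\<in>span B. \<Sum>t\<in>UNIV. t ^ 0 * prod_forms [] x * prod_forms fs (x + scale t v))"
      by (simp add: sum.cartesian_product)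
    also have "\<dots> = 0"
    proof (rule sum_prod_forms_line[where m = "card B * (q - 1)"])
      show "(\<Sum>x\<in>span B. prod_forms gs x) = 0"
        if "list_all aform gs" "length gs < card B * (q - 1)" for gs
        using insert.IH v(2) that by blast
    qed (use insert in auto)
    finally show ?case .
  qed simp
qed

lemma flat_in_dual:
  assumes "subspace U" "card U = q ^ s"
  shows "(\<lambda>x. if x - p \<in> U then c else 0) \<in> dual (s * (q - 1))"
proof (rule dualI)
  fix fs assume fs: "list_all aform fs" "length fs < s * (q - 1)"
  obtain B where B: "B \<subseteq> U" "independent B" "U \<subseteq> span B" using basis_exists by metis
  have U: "span B = U" using B assms(1) by (simp add: span_minimal subset_antisym)
  then have "card B = s" using card_span_independent[OF B(2)] assms(2) q_ge_2 by simp
  let ?fs = "map (\<lambda>f x. f (x + p)) fs"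
  have "(\<Sum>x\<in>UNIV. (if x - p \<in> U then c else 0) * prod_forms fs x) =
    (\<Sum>x\<in>UNIV. if x \<in> U then c * prod_forms ?fs x else 0)"
    by (rule sum.reindex_bij_witness[of _ "\<lambda>x. x + p" "\<lambda>x. x - p"]) (auto simp: prod_forms_def o_def)
  also have "\<dots> = c * (\<Sum>x\<in>U. prod_forms ?fs x)"
    by (simp add: sum.If_cases sum_distrib_left)
  also have "(\<Sum>x\<in>U. prod_forms ?fs x) = 0"
    unfolding U[symmetric] using B(2) fs \<open>card B = s\<close>
    by (intro sum_prod_forms_span) (auto simp: list_all_iff aform_translate)
  finally show "(\<Sum>x\<in>UNIV. (if x - p \<in> U then c else 0) * prod_forms fs x) = 0" by simp
qed

section \<open>Moments along a direction\<close>

text \<open>The moment of each line in direction \<open>w\<close> is recorded at its point on the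
  hyperplane \<open>th = 0\<close>. Pairing with \<open>fs\<close> equals pairing \<open>u\<close>
  with \<open>d\<close> copies of \<open>th\<close> and the forms pulled back along the projection
  \<open>y - th y w\<close>, so \<open>d\<close> degrees are spent.\<close>

lemma line_moment_in_dual:
  assumes u: "u \<in> dual r" and th: "lform th" "th w = 1"
  shows "(\<lambda>x. if th x = 0 then \<Sum>t\<in>UNIV. u (x + scale t w) * t ^ d else 0) \<in> dual (r - d)"
proof (rule dualI)
  fix fs assume fs: "list_all aform fs" "length fs < r - d"
  let ?P = "\<lambda>y. y - scale (th y) w"
  let ?gs = "replicate d th @ map (\<lambda>f y. f (?P y)) fs"
  have P_add: "?P (x + y) = ?P x + ?P y" for x y
    using th(1) by (simp add: lform_def scale_left_distrib algebra_simps)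
  have P_scale: "?P (scale c x) = scale c (?P x)" for c x
    using th(1) by (simp add: lform_def scale_right_diff_distrib)
  have "aform (\<lambda>y. f (?P y))" if f: "aform f" for f
  proof -
    obtain g c where "lform g" "f = (\<lambda>x. g x + c)" using f by (auto simp: aform_def)
    moreover from \<open>lform g\<close> have "lform (\<lambda>y. g (?P y))"
      by (simp only: lform_def P_add P_scale) simp
    ultimately show ?thesis by (auto intro: aform_lform)
  qed
  then have gs: "list_all aform ?gs" using fs(1) th(1) by (auto simp: list_all_iff lform_imp_aform)
  have "(\<Sum>x\<in>UNIV. (if th x = 0 then \<Sum>t\<in>UNIV. u (x + scale t w) * t ^ d else 0) * prod_forms fs x) =
      (\<Sum>x\<in>{x. th x = 0}. \<Sum>t\<in>UNIV. u (x + scale t w) * t ^ d * prod_forms fs x)"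
    by (simp add: if_distrib[of "\<lambda>a. a * _"] sum.If_cases sum_distrib_right cong: if_cong)
  also have "\<dots> = (\<Sum>(x, t)\<in>{x. th x = 0} \<times> UNIV. u (x + scale t w) * t ^ d * prod_forms fs x)"
    by (simp add: sum.cartesian_product)
  also have "\<dots> = (\<Sum>y\<in>UNIV. u y * th y ^ d * prod_forms fs (?P y))"
    by (rule sum.reindex_bij_witness[of _ "\<lambda>y. (?P y, th y)" "\<lambda>(x, t). x + scale t w"])
      (auto simp: lform_add[OF th(1)] lform_diff[OF th(1)] lform_scale[OF th(1)] th(2))
  also have "\<dots> = (\<Sum>y\<in>UNIV. u y * prod_forms ?gs y)"
    by (simp add: mult.assoc) (simp add: prod_forms_def o_def)
  also have "\<dots> = 0" using gs fs(2) by (intro dualD[OF u]) auto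
  finally show "(\<Sum>x\<in>UNIV. (if th x = 0 then \<Sum>t\<in>UNIV. u (x + scale t w) * t ^ d else 0) * prod_forms fs x) = 0" .
qed

text \<open>On the line through a point of \<open>X\<close> the word is nonzero but its moments
  below \<open>d\<close> vanish, so more than \<open>d\<close> support points lie there. The lines
  are disjoint because \<open>X\<close> lies in a hyperplane transversal to
  \<open>w\<close>.\<close>

lemma card_supp_ge_of_line_moment:
  assumes th: "lform th" "th w = 1"
    and X: "\<And>x. x \<in> X \<Longrightarrow> th x = 0"
    and low: "\<And>x j. x \<in> X \<Longrightarrow> j < d \<Longrightarrow> (\<Sum>t\<in>UNIV. u (x + scale t w) * t ^ j) = 0"
    and top: "\<And>x. x \<in> X \<Longrightarrow> (\<Sum>t\<in>UNIV. u (x + scale t w) * t ^ d) \<noteq> 0"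
  shows "(d + 1) * card X \<le> card (supp u)"
proof -
  let ?P = "\<lambda>y. y - scale (th y) w"
  have "w \<noteq> 0" using th lform_0 by force
  have fib: "d + 1 \<le> card {y \<in> supp u. ?P y = x}" if x: "x \<in> X" for x
  proof -
    obtain a where a: "u (x + scale a w) \<noteq> 0"
      using top[OF x] by (metis (no_types, lifting) mult_zero_left sum.neutral)
    have "d < card {t. u (x + scale t w) \<noteq> 0}"
      by (rule card_support_gt_of_vanishing_moments[OF low[OF x] a])
    also have "\<dots> = card ((\<lambda>t. x + scale t w) ` {t. u (x + scale t w) \<noteq> 0})"
      using \<open>w \<noteq> 0\<close> by (intro card_image[symmetric]) (auto simp: inj_on_def)
    also have "\<dots> \<le> card {y \<in> supp u. ?P y = x}"
      using X[OF x] th by (intro card_mono) (auto simp: supp_def lform_add lform_scale)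
    finally show ?thesis by simp
  qed
  have "(d + 1) * card X = (\<Sum>x\<in>X. d + 1)" by simp
  also have "\<dots> \<le> (\<Sum>x\<in>X. card {y \<in> supp u. ?P y = x})" by (rule sum_mono) (rule fib)
  also have "\<dots> \<le> (\<Sum>x\<in>UNIV. card {y \<in> supp u. ?P y = x})" by (rule sum_mono2) auto
  also have "\<dots> = card (supp u)" by (rule card_eq_sum_fibres[symmetric]) auto
  finally show ?thesis .
qed

text \<open>All moments along \<open>w\<close> of order below \<open>q - 1\<close> are shown to
  vanish, lowest order first; then \<open>u\<close> is constant on each line. Constancy on one slice
  serves to exclude a nonzero moment of order 0.\<close>

lemma invariant_along_constant_slice:
  assumes u: "u \<in> dual (Suc s * (q - 1))" and small: "card (supp u) < 2 * (q - 1) * q ^ s"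
    and "q > 2" and l: "lform l" "l ` supp u = UNIV" "l w = 0"
    and const: "\<And>x t. l x = c \<Longrightarrow> u (x + scale t w) = u x"
  shows "u (x + scale t w) = u x"
proof (cases "w = 0")
  case False
  then obtain th where th: "lform th" "th w = 1"
    using lform_separating[of "{0}" w] by (auto simp: subspace_def)
  define V where "V d x = (if th x = 0 then \<Sum>t\<in>UNIV. u (x + scale t w) * t ^ d else 0)" for d x
  have V_dual: "V d \<in> dual (Suc s * (q - 1) - d)" for d
    unfolding V_def by (rule line_moment_in_dual[OF u th])
  have V_th: "th x = 0" if "x \<in> supp (V d)" for x d
    using that by (auto simp: supp_def V_def split: if_splits)
  have V_nonzero: "(\<Sum>t\<in>UNIV. u (x + scale t w) * t ^ d) \<noteq> 0" if "x \<in> supp (V d)" for x d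
    using that by (auto simp: supp_def V_def split: if_splits)
  have all0: "V d x = 0" if "d < q - 1" for d x
    using that
  proof (induction d arbitrary: x rule: less_induct)
    case (less d)
    show ?case
    proof (rule ccontr)
      assume "V d x \<noteq> 0"
      then have x: "x \<in> supp (V d)" by (simp add: supp_def)
      have low: "(\<Sum>t\<in>UNIV. u (y + scale t w) * t ^ j) = 0" if "y \<in> supp (V d)" "j < d" for y j
        using less.IH[of j y] less.prems that V_th[OF that(1)] by (simp add: V_def)
      have many: "(d + 1) * card (supp (V d)) \<le> card (supp u)"
        by (rule card_supp_ge_of_line_moment[OF th V_th low V_nonzero])
      show False
      proof (cases d)
        \<comment> \<open>At least \<open>(q - d) q ^ s\<close> lines carry \<open>d + 1\<close> or
          more support points each, and \<open>(d + 1) (q - d) \<ge> 2 (q - 1)\<close> for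
          \<open>1 \<le> d \<le> q - 2\<close>.\<close>
        case (Suc e)
        define g where "g = q - 2 - d"
        have q: "q = e + g + 3" using Suc less.prems unfolding g_def by linarith
        have "Suc s * (q - 1) - d = s * (q - 1) + (q - 1 - d)" using less.prems by simp
        moreover have "q - 1 - d < q - 1" using Suc less.prems by simp
        moreover have "q - 1 - d + 1 = g + 2" using q Suc by simp
        ultimately have "min_weight (Suc s * (q - 1) - d) = (g + 2) * q ^ s"
          by (simp only: min_weight_eq)
        then have "(d + 1) * ((g + 2) * q ^ s) \<le> (d + 1) * card (supp (V d))"
          using min_weight_le_card_supp[OF V_dual x] by (intro mult_left_mono) simp_all
        moreover have "2 * (q - 1) \<le> (d + 1) * (g + 2)" using q Suc by simp
        then have "2 * (q - 1) * q ^ s \<le> (d + 1) * (g + 2) * q ^ s" by (rule mult_right_mono) simp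
        ultimately show False using many small unfolding mult.assoc by linarith
      next
        case 0
        have l_line: "l (y + scale t w) = l y" for y t
          using l by (simp add: lform_add lform_scale)
        have V0: "V 0 \<in> dual (Suc s * (q - 1))" using V_dual[of 0] by simp
        have le: "card (supp (V 0)) \<le> card (supp u)" using many 0 by simp
        \<comment> \<open>On the slice \<open>l = c\<close> the moment of order 0 is
          \<open>q\<close> times a letter, which is zero in the field. So \<open>V 0\<close> misses
          the value \<open>c\<close>, and being light it must lie on a single hyperplane
          \<open>l = c1\<close>.\<close>
        have "c \<notin> l ` supp (V 0)"
        proof
          assume "c \<in> l ` supp (V 0)"
          then obtain y where y: "y \<in> supp (V 0)" "l y = c" by auto
          have "(\<Sum>t\<in>UNIV. u (y + scale t w) * t ^ 0) = (\<Sum>t\<in>UNIV. u y * (t::'k) ^ 0)"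
            using const[OF y(2)] by simp
          also have "\<dots> = u y * (\<Sum>t\<in>UNIV. (t::'k) ^ 0)" by (simp only: sum_distrib_left)
          also have "(\<Sum>t\<in>UNIV. (t::'k) ^ 0) = 0"
            using \<open>q > 2\<close> by (intro sum_power_finite_field) (simp add: q_eq)
          finally show False using V_nonzero[OF y(1)] by simp
        qed
        then have "l ` supp (V 0) \<subseteq> UNIV - {c}" by auto
        then have "card (l ` supp (V 0)) \<le> card (UNIV - {c})" by (intro card_mono) auto
        then have "card (l ` supp (V 0)) \<le> q - 1" by (simp add: card_Diff_singleton q_eq)
        then have "\<not> 2 \<le> card (l ` supp (V 0))"
          using card_supp_ge_of_missed_value[OF V0 l(1)] le small by linarith
        moreover have "card (l ` supp (V 0)) > 0" using x 0 by (auto simp: card_gt_0_iff)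
        ultimately have "card (l ` supp (V 0)) = 1" by linarith
        then obtain c1 where c1: "l ` supp (V 0) = {c1}" by (auto simp: card_1_singleton_iff)
        \<comment> \<open>Lines in direction \<open>w\<close> stay inside \<open>l = c1\<close>,
          since \<open>l w = 0\<close>; so this slice of \<open>u\<close> is at least as large as
          the support of \<open>V 0\<close>.\<close>
        have "q ^ Suc s \<le> card (supp (V 0))"
          using min_weight_le_card_supp[OF V0, of x] x 0 min_weight_eq[of 0 "Suc s"] \<open>q > 2\<close> by simp
        also have "\<dots> \<le> card (supp (slice l c1 u))"
        proof -
          have "(0 + 1) * card (supp (V 0)) \<le> card (supp (slice l c1 u))"
          proof (rule card_supp_ge_of_line_moment[OF th])
            fix y assume y: "y \<in> supp (V 0)"
            show "th y = 0" by (rule V_th[OF y])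
            have "l y = c1" using y c1 by auto
            then show "(\<Sum>t\<in>UNIV. slice l c1 u (y + scale t w) * t ^ 0) \<noteq> 0"
              using V_nonzero[OF y] by (simp add: slice_def l_line)
          qed simp
          then show ?thesis by simp
        qed
        finally have big: "q ^ Suc s \<le> card (supp (slice l c1 u))" .
        have each: "q ^ s \<le> card (supp (slice l b u))" for b
        proof -
          have "Suc s * (q - 1) - (card (l ` supp u) - 1) = s * (q - 1)" using l(2) by (simp add: q_eq)
          then have "min_weight (s * (q - 1)) \<le> card (supp (slice l b u))"
            using card_supp_slices_ge[OF u l(1), of b] l(2) by simp
          then show ?thesis using min_weight_eq[of 0 s] \<open>q > 2\<close> by simp
        qed
        \<comment> \<open>One slice of weight \<open>q ^ Suc s\<close> and \<open>q - 1\<close>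
          slices of weight \<open>q ^ s\<close> together exceed the allowed support.\<close>
        have "q ^ Suc s + (q - 1) * q ^ s = q ^ Suc s + (\<Sum>b\<in>UNIV - {c1}. q ^ s)"
          by (simp add: card_Diff_singleton q_eq)
        also have "\<dots> \<le> card (supp (slice l c1 u)) + (\<Sum>b\<in>UNIV - {c1}. card (supp (slice l b u)))"
          by (intro add_mono big sum_mono each)
        also have "\<dots> = card (supp u)"
          by (subst card_supp_slices[of l u UNIV]) (auto simp: sum.remove[of UNIV c1])
        finally have "(q + (q - 1)) * q ^ s \<le> card (supp u)" by (simp only: add_mult_distrib power_Suc)
        moreover have "2 * (q - 1) * q ^ s \<le> (q + (q - 1)) * q ^ s" by (rule mult_right_mono) auto
        ultimately show False using small by linarith
      qed
    qed
  qed
  \<comment> \<open>This is the point with \<open>th y = 0\<close> on the line through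
    \<open>x\<close>, where \<open>V\<close> records the moments.\<close>
  define y where "y = x - scale (th x) w"
  have "th y = 0" using th by (simp add: y_def lform_diff lform_scale)
  then have m: "(\<Sum>t\<in>UNIV. u (y + scale t w) * t ^ j) = 0" if "j < CARD('k) - 1" for j
    using all0[of j y] that by (simp add: V_def q_eq)
  have "u (y + scale (th x + t) w) = u (y + scale (th x) w)"
    by (rule constant_of_vanishing_moments[of "\<lambda>t. u (y + scale t w)", OF m])
  then show ?thesis by (simp add: y_def scale_left_distrib add_ac)
qed simp

section \<open>Words of small weight\<close>

text \<open>Otherwise forms \<open>f1\<close>, \<open>f2\<close> vanishing on \<open>W\<close> map
  \<open>p0\<close>, \<open>p1\<close>, \<open>p2\<close> to a triangle. Every nontrivial
  combination of them separates two of these points, hence takes all values on the support, so the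
  image is a blocking set; each of its fibres contains a coset of \<open>W\<close>.\<close>

lemma supp_subset_flat_of_blocking:
  assumes u: "card (supp u) < (2 * q - 1) * card W"
    and W: "subspace W" "\<And>x w. w \<in> W \<Longrightarrow> u (x + w) = u x"
    and blocking: "\<And>f. lform f \<Longrightarrow> 2 \<le> card (f ` supp u) \<Longrightarrow> f ` supp u = UNIV"
    and p: "p0 \<in> supp u" "p1 \<in> supp u" "p1 - p0 \<notin> W" "p2 \<in> supp u"
  shows "p2 - p0 \<in> span (insert (p1 - p0) W)"
proof (rule ccontr)
  assume n2: "p2 - p0 \<notin> span (insert (p1 - p0) W)"
  have spanW: "span W = W" using W(1) by (simp add: span_eq_iff)
  \<comment> \<open>The exchange property makes the situation symmetric in \<open>p1\<close> and
    \<open>p2\<close>, so both separating forms exist.\<close>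
  have n1: "p1 - p0 \<notin> span (insert (p2 - p0) W)"
    using in_span_insert[of "p1 - p0" "p2 - p0" W] n2 p(3) spanW by auto
  obtain f1 where f1: "lform f1" "\<And>x. x \<in> span (insert (p2 - p0) W) \<Longrightarrow> f1 x = 0" "f1 (p1 - p0) = 1"
    using lform_separating[OF subspace_span n1] by metis
  obtain f2 where f2: "lform f2" "\<And>x. x \<in> span (insert (p1 - p0) W) \<Longrightarrow> f2 x = 0" "f2 (p2 - p0) = 1"
    using lform_separating[OF subspace_span n2] by metis
  have W0: "f1 w = 0" "f2 w = 0" if "w \<in> W" for w
    using that f1(2) f2(2) by (auto intro: span_base)
  have "f1 (p2 - p0) = 0" "f2 (p1 - p0) = 0" using f1(2) f2(2) by (auto intro: span_base)
  define B where "B = (\<lambda>x. (f1 x, f2 x)) ` supp u"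
  have "2 * CARD('k) - 1 \<le> card B"
  proof (rule card_affine_blocking_set_plane)
    fix a b c :: 'k assume "(a, b) \<noteq> (0, 0)"
    define f where "f x = a * f1 x + b * f2 x" for x
    have f: "lform f" unfolding f_def by (rule lform_combination[OF f1(1) f2(1)])
    have "f (p1 - p0) = a" "f (p2 - p0) = b"
      using f1(3) f2(3) \<open>f1 (p2 - p0) = 0\<close> \<open>f2 (p1 - p0) = 0\<close> by (simp_all add: f_def)
    then have "f p1 \<noteq> f p0 \<or> f p2 \<noteq> f p0"
      using \<open>(a, b) \<noteq> (0, 0)\<close> by (auto simp: lform_diff[OF f])
    then have "\<not> card (f ` supp u) \<le> Suc 0"
      using p by (subst card_le_Suc0_iff_eq) auto
    then have "c \<in> f ` supp u" using blocking[OF f] by simp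
    then show "\<exists>y\<in>B. a * fst y + b * snd y = c" by (auto simp: B_def f_def)
  qed
  then have "(2 * q - 1) * card W \<le> (\<Sum>y\<in>B. card W)" by (simp add: q_eq)
  also have "\<dots> \<le> (\<Sum>y\<in>B. card {x \<in> supp u. (f1 x, f2 x) = y})"
  proof (rule sum_mono)
    fix y assume "y \<in> B"
    then obtain x where x: "x \<in> supp u" "y = (f1 x, f2 x)" by (auto simp: B_def)
    have "card W = card ((\<lambda>w. x + w) ` W)" by (simp add: card_image)
    also have "\<dots> \<le> card {x \<in> supp u. (f1 x, f2 x) = y}"
      using x W(2) W0 f1(1) f2(1) by (intro card_mono) (auto simp: supp_def lform_add)
    finally show "card W \<le> card {x \<in> supp u. (f1 x, f2 x) = y}" .
  qed
  also have "\<dots> = card (supp u)" by (rule card_eq_sum_fibres[symmetric]) (auto simp: B_def)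
  finally show False using u by simp
qed

text \<open>Subtracting the multiple of the indicator that agrees with \<open>u\<close> at
  \<open>p\<close> leaves a word in the dual with fewer than \<open>q ^ s\<close> nonzero letters,
  below the minimum weight.\<close>

lemma flat_of_supp_subset:
  assumes u: "u \<in> dual (s * (q - 1))" and U: "subspace U" "card U = q ^ s"
    and p: "p \<in> supp u" "\<And>x. x \<in> supp u \<Longrightarrow> x - p \<in> U"
  shows "u = (\<lambda>x. if x - p \<in> U then u p else 0)"
proof -
  define v where "v x = u x - (if x - p \<in> U then u p else 0)" for x
  have v: "v \<in> dual (s * (q - 1))"
    unfolding v_def by (intro dual_diff u flat_in_dual U)
  have "supp v \<subseteq> (\<lambda>w. p + w) ` (U - {0})"
  proof
    fix x assume "x \<in> supp v"
    then have "x - p \<in> U - {0}"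
      using p(2)[of x] by (auto simp: supp_def v_def split: if_splits)
    then show "x \<in> (\<lambda>w. p + w) ` (U - {0})" by (intro image_eqI[of _ _ "x - p"]) auto
  qed
  then have "card (supp v) \<le> card ((\<lambda>w. p + w) ` (U - {0}))" by (intro card_mono) auto
  also have "\<dots> = card (U - {0})" by (simp add: card_image)
  also have "\<dots> < q ^ s" using subspace_0[OF U(1)] U(2) q_ge_2 by (simp add: card_Diff_singleton)
  finally have "supp v = {}"
    using min_weight_le_card_supp[OF v] min_weight_eq[of 0 s] q_ge_2 by fastforce
  then show ?thesis by (auto simp: supp_def v_def)
qed

text \<open>The bound on the support is \<open>2 (q - 1) q\<^sup>s\<^sup>-\<^sup>1\<close>, multiplied by \<open>q\<close> so as to make sense for
  \<open>s = 0\<close>, where the induction starts.\<close>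

lemma flat_of_small_supp:
  assumes "u \<in> dual (s * (q - 1))" "supp u \<noteq> {}" "q * card (supp u) < 2 * (q - 1) * q ^ s" "q > 2"
  shows "\<exists>p U c. subspace U \<and> card U = q ^ s \<and> c \<noteq> 0 \<and> u = (\<lambda>x. if x - p \<in> U then c else 0)"
  using assms
proof (induction s arbitrary: u)
  case 0
  then obtain p where p: "p \<in> supp u" by auto
  \<comment> \<open>The bound leaves a single support point, which is a coset of
    \<open>{0}\<close>.\<close>
  have "2 * (q - 1) * q ^ 0 \<le> q * 2" by simp
  then have "q * card (supp u) < q * 2" using "0.prems"(3) by linarith
  then have "card (supp u) < 2" by simp
  then have "\<forall>x\<in>supp u. \<forall>y\<in>supp u. x = y" by (simp flip: card_le_Suc0_iff_eq)
  then have "supp u = {p}" using p by blast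
  then have "u x \<noteq> 0 \<longleftrightarrow> x = p" for x unfolding supp_def by blast
  then have "u = (\<lambda>x. if x - p \<in> {0} then u p else 0)" "u p \<noteq> 0" by (auto simp: fun_eq_iff)
  then show ?case by (intro exI[of _ p] exI[of _ "{0}"] exI[of _ "u p"]) (auto simp: subspace_def)
next
  case (Suc s)
  have small: "card (supp u) < 2 * (q - 1) * q ^ s"
  proof -
    have "q * card (supp u) < q * (2 * (q - 1) * q ^ s)" using Suc.prems(3) by (simp add: mult_ac)
    then show ?thesis by simp
  qed
  have blocking: "f ` supp u = UNIV" if "lform f" "2 \<le> card (f ` supp u)" for f
  proof -
    have "\<not> card (f ` supp u) \<le> q - 1"
      using card_supp_ge_of_missed_value[OF Suc.prems(1) that] small by linarith
    then have "CARD('k) \<le> card (f ` supp u)" by (simp add: q_eq)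
    then show ?thesis by (metis card_seteq finite_class.finite_UNIV subset_UNIV)
  qed
  obtain p0 where p0: "p0 \<in> supp u" using Suc.prems(2) by auto
  have "q ^ Suc s \<le> card (supp u)"
    using min_weight_le_card_supp[OF Suc.prems(1) p0] min_weight_eq[of 0 "Suc s"] \<open>q > 2\<close> by simp
  moreover have "q ^ 1 \<le> q ^ Suc s" using \<open>q > 2\<close> by (intro power_increasing) auto
  ultimately have "\<not> card (supp u) \<le> Suc 0" using \<open>q > 2\<close> unfolding power_one_right by linarith
  then obtain p' where "p' \<in> supp u" "p' \<noteq> p0" using p0 by (subst (asm) card_le_Suc0_iff_eq) auto
  then obtain l where l: "lform l" "l p' \<noteq> l p0" using lform_separating_points by metis
  then have "\<not> card (l ` supp u) \<le> Suc 0"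
    using p0 \<open>p' \<in> supp u\<close> by (subst card_le_Suc0_iff_eq) auto
  then have surj: "l ` supp u = UNIV" using blocking[OF l(1)] by simp
  \<comment> \<open>By averaging over the \<open>q\<close> slices; the factor \<open>q\<close> saved
    is exactly what the induction hypothesis requires.\<close>
  obtain c where c: "q * card (supp (slice l c u)) \<le> card (supp u)"
  proof (rule ccontr)
    assume "\<not> thesis"
    then have "card (supp u) < q * card (supp (slice l c u))" for c using that not_le by blast
    then have "(\<Sum>c\<in>(UNIV::'k set). card (supp u)) < (\<Sum>c\<in>UNIV. q * card (supp (slice l c u)))"
      by (intro sum_strict_mono) auto
    also have "\<dots> = q * card (supp u)"
      by (simp add: card_supp_slices[of l u UNIV] flip: sum_distrib_left)
    finally show False by (simp add: q_eq)
  qed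
  have "slice l c u \<in> dual (Suc s * (q - 1) - (card (l ` supp u) - 1))"
    by (rule slice_in_dual) (use Suc.prems l surj in auto)
  then have "slice l c u \<in> dual (s * (q - 1))" by (simp add: surj q_eq)
  moreover have "supp (slice l c u) \<noteq> {}" using surj unfolding supp_slice
    by (metis (mono_tags, lifting) UNIV_I empty_iff imageE mem_Collect_eq)
  moreover have "q * card (supp (slice l c u)) < 2 * (q - 1) * q ^ s" using c small by linarith
  ultimately obtain p W a where W: "subspace W" "card W = q ^ s" "a \<noteq> 0"
    and slice: "slice l c u = (\<lambda>x. if x - p \<in> W then a else 0)"
    using Suc.IH Suc.prems(4) by metis
  \<comment> \<open>The flat \<open>p + W\<close> is the support of a slice, so \<open>l\<close>
    equals \<open>c\<close> on all of it.\<close>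
  have lW: "l w = 0" if "w \<in> W" for w
  proof -
    have "l (p + w) = c" "l p = c"
      using fun_cong[OF slice, of "p + w"] fun_cong[OF slice, of p] that W subspace_0[OF W(1)]
      by (auto simp: slice_def split: if_splits)
    then show ?thesis by (simp add: lform_add[OF l(1)])
  qed
  have inv: "u (x + w) = u x" if w: "w \<in> W" for x w
  proof -
    have "u (x + scale t w) = u x" if "l x = c" for x t
    proof -
      have "l (x + scale t w) = c" using that lW[OF w] by (simp add: lform_add[OF l(1)] lform_scale[OF l(1)])
      moreover have "x + scale t w - p \<in> W \<longleftrightarrow> x - p \<in> W"
        using subspace_add[OF W(1), of "x - p" "scale t w"] subspace_diff[OF W(1), of "x + scale t w - p" "scale t w"]
          subspace_scale[OF W(1) w] by (auto simp: algebra_simps)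
      ultimately show ?thesis
        using fun_cong[OF slice, of x] fun_cong[OF slice, of "x + scale t w"] that by (simp add: slice_def)
    qed
    then have "u (x + scale 1 w) = u x"
      by (rule invariant_along_constant_slice[OF Suc.prems(1) small \<open>q > 2\<close> l(1) surj lW[OF w]])
    then show ?thesis by simp
  qed
  have nW: "p' - p0 \<notin> W" using lW[of "p' - p0"] l(2) unfolding lform_diff[OF l(1)] by auto
  let ?U = "span (insert (p' - p0) W)"
  \<comment> \<open>The support has fewer points than the \<open>2 q - 1\<close> cosets of
    \<open>W\<close> forced by a blocking set of a plane, so modulo \<open>W\<close> it lies on a
    line.\<close>
  have "2 * (q - 1) * q ^ s \<le> (2 * q - 1) * card W" unfolding W(2) by (rule mult_right_mono) auto
  then have sub: "x - p0 \<in> ?U" if "x \<in> supp u" for x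
    using supp_subset_flat_of_blocking[OF _ W(1) inv blocking p0 \<open>p' \<in> supp u\<close> nW that] small by linarith
  have spanW: "span W = W" using W(1) by (simp add: span_eq_iff)
  have "card ?U = q * card (span W)" by (rule card_span_insert) (simp only: spanW nW not_False_eq_True)
  then have "card ?U = q ^ Suc s" by (simp only: spanW W(2) power_Suc)
  then have "u = (\<lambda>x. if x - p0 \<in> ?U then u p0 else 0)"
    by (intro flat_of_supp_subset[OF Suc.prems(1) subspace_span _ p0 sub])
  moreover have "u p0 \<noteq> 0" using p0 by (simp add: supp_def)
  ultimately show ?case using \<open>card ?U = q ^ Suc s\<close> subspace_span by blast
qed

end

section \<open>Reed-Muller codes\<close>

text \<open>Exponents drop by \<open>q - 1\<close>, where \<open>q = CARD('k)\<close>, as long as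
  they exceed \<open>q - 1\<close>. They thus never reach 0 from a positive value, which would
  change the value at \<open>t = 0\<close>.\<close>

lemma reduce_exponent:
  "\<exists>e'\<le>e. e' \<le> CARD('k) - 1 \<and> (\<forall>t::'k::{field,finite}. t ^ e = t ^ e')"
proof (induction e rule: less_induct)
  case (less e)
  have q2: "2 \<le> CARD('k)" using card_mono[of UNIV "{0, 1::'k}"] by simp
  show ?case
  proof (cases "e \<le> CARD('k) - 1")
    case False
    define e1 where "e1 = Suc (e - CARD('k))"
    have "e1 < e" using False q2 by (simp add: e1_def)
    moreover have "t ^ e = t ^ e1" for t :: 'k
    proof -
      have "t ^ e = t ^ (CARD('k) + (e - CARD('k)))" using False by simp
      also have "\<dots> = t ^ e1" unfolding power_add power_card_finite_field by (simp add: e1_def)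
      finally show ?thesis .
    qed
    moreover obtain e' where "e' \<le> e1" "e' \<le> CARD('k) - 1" "\<And>t::'k. t ^ e1 = t ^ e'"
      using less.IH[OF \<open>e1 < e\<close>] by blast
    ultimately show ?thesis by (intro exI[of _ e']) auto
  qed auto
qed

definition monomial :: "('n \<Rightarrow> nat) \<Rightarrow> 'k ^ 'n \<Rightarrow> 'k::field" where
  "monomial m v = (\<Prod>i\<in>UNIV. v $ i ^ m i)"

lemma mv_total_degree_le_iff:
  "mv_total_degree p \<le> r \<longleftrightarrow>
     -1 \<le> r \<and> (\<forall>m\<in>Poly_Mapping.keys p. int (\<Sum>i\<in>UNIV. Poly_Mapping.lookup m i) \<le> r)"
  unfolding mv_total_degree_def by (subst Max_le_iff) auto

lemma reed_muller_iff:
  fixes g :: "'k::{field,finite} ^ 'n::finite \<Rightarrow> 'k"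
  shows "g \<in> reed_muller r \<longleftrightarrow> -1 \<le> r \<and> (\<exists>p. reduced_poly p \<and> mv_eval p = g \<and>
    (\<forall>m\<in>Poly_Mapping.keys p. int (\<Sum>i\<in>UNIV. Poly_Mapping.lookup m i) \<le> r))"
proof -
  have rep: "reduced_poly (reduced_rep g) \<and> mv_eval (reduced_rep g) = g"
    unfolding reduced_rep_def by (rule theI'[OF reduced_representation])
  have unique: "p = reduced_rep g" if "reduced_poly p" "mv_eval p = g" for p
    unfolding reduced_rep_def
    by (rule the1_equality[OF reduced_representation, symmetric]) (use that in simp)
  show ?thesis
    unfolding reed_muller_def fun_degree_def mem_Collect_eq mv_total_degree_le_iff
    using rep by (auto dest: unique intro!: exI[of _ "reduced_rep g"])
qed

text \<open>Reducing the exponents of the monomial does not raise its degree, and adding it to the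
  reduced polynomial of \<open>g\<close> introduces at most one new key, even if coefficients
  cancel.\<close>

lemma reed_muller_add_monomial:
  fixes g :: "'k::{field,finite} ^ 'n::finite \<Rightarrow> 'k"
  assumes g: "g \<in> reed_muller r" and m: "int (\<Sum>i\<in>UNIV. m i) \<le> r"
  shows "(\<lambda>v. c * monomial m v + g v) \<in> reed_muller r"
proof -
  have "\<forall>i. \<exists>e. e \<le> m i \<and> e \<le> CARD('k) - 1 \<and> (\<forall>t::'k. t ^ m i = t ^ e)"
    using reduce_exponent[where 'k='k] by blast
  from choice[OF this] obtain m'
    where m': "\<And>i. m' i \<le> m i" "\<And>i. m' i \<le> CARD('k) - 1" "\<And>i t. (t::'k) ^ m i = t ^ m' i"
    by auto
  define e where "e = Abs_poly_mapping m'"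
  have e: "Poly_Mapping.lookup e = m'" unfolding e_def by (rule lookup_Abs_poly_mapping) simp
  obtain p where p: "reduced_poly p" "mv_eval p = g" "-1 \<le> r"
    "\<forall>m\<in>Poly_Mapping.keys p. int (\<Sum>i\<in>UNIV. Poly_Mapping.lookup m i) \<le> r"
    using g unfolding reed_muller_iff by blast
  define p' where "p' = Poly_Mapping.single e c + p"
  have keys: "Poly_Mapping.keys p' \<subseteq> insert e (Poly_Mapping.keys p)"
    unfolding p'_def using Poly_Mapping.keys_add[of "Poly_Mapping.single e c" p] by (auto split: if_splits)
  have "reduced_poly p'"
    using p(1) m'(2) keys by (auto simp: reduced_poly_def e dest!: subsetD)
  moreover have "mv_eval p' v = c * monomial m v + g v" for v
  proof -
    let ?E = "insert e (Poly_Mapping.keys p)"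
    let ?M = "\<lambda>m. \<Prod>i\<in>UNIV. v $ i ^ Poly_Mapping.lookup m i"
    have "mv_eval p' v = (\<Sum>m\<in>?E. (if m = e then c * ?M m else 0) + Poly_Mapping.lookup p m * ?M m)"
      by (subst mv_eval_alt[OF _ keys])
        (auto simp: p'_def lookup_add lookup_single when_def algebra_simps intro!: sum.cong)
    also have "\<dots> = c * ?M e + mv_eval p v"
      by (simp add: sum.distrib mv_eval_alt[of ?E p] subset_insertI)
    finally show ?thesis using p(2) by (simp add: monomial_def e m'(3))
  qed
  moreover have "int (\<Sum>i\<in>UNIV. Poly_Mapping.lookup e i) \<le> r"
    unfolding e by (rule order_trans[OF _ m]) (auto simp del: of_nat_sum intro: sum_mono m'(1))
  then have "\<forall>m\<in>Poly_Mapping.keys p'. int (\<Sum>i\<in>UNIV. Poly_Mapping.lookup m i) \<le> r"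
    using keys p(4) by blast
  ultimately show ?thesis unfolding reed_muller_iff using p(3) by blast
qed

text \<open>Polynomial functions built one monomial at a time, with unrestricted exponents in each
  variable. They link products of affine forms to \<open>reed_muller\<close>, whose polynomials are
  reduced.\<close>

inductive poly_fun :: "nat \<Rightarrow> ('k::{field,finite} ^ 'n::finite \<Rightarrow> 'k) \<Rightarrow> bool" for r where
  zero: "poly_fun r (\<lambda>_. 0)"
| add: "poly_fun r g \<Longrightarrow> (\<Sum>i\<in>UNIV. m i) \<le> r \<Longrightarrow> poly_fun r (\<lambda>v. c * monomial m v + g v)"

lemma poly_fun_imp_reed_muller:
  assumes "poly_fun d g" "int d \<le> r"
  shows "g \<in> reed_muller r"
  using assms(1)
proof induction
  case zero
  show ?case using assms(2)
    by (auto simp: reed_muller_iff reduced_poly_def mv_eval_def intro!: exI[of _ 0])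
next
  case (add g m c)
  then have "int (\<Sum>i\<in>UNIV. m i) \<le> r" using assms(2) by (simp only: of_nat_le_iff order_trans[of _ "int d"])
  then show ?case by (rule reed_muller_add_monomial[OF add.IH])
qed

lemma poly_fun_add_monomials:
  assumes "finite I" "poly_fun r g" "\<And>i. i \<in> I \<Longrightarrow> (\<Sum>j\<in>UNIV. m i j) \<le> r"
  shows "poly_fun r (\<lambda>v. (\<Sum>i\<in>I. c i * monomial (m i) v) + g v)"
  using assms
proof (induction I rule: finite_induct)
  case (insert i I)
  then show ?case using poly_fun.add[of r "\<lambda>v. (\<Sum>i\<in>I. c i * monomial (m i) v) + g v" "m i" "c i"]
    by (simp add: add.assoc)
qed simp

lemma monomial_mult_coordinate:
  "v $ i * monomial m v = monomial (m(i := Suc (m i))) v"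
  by (simp add: monomial_def prod.remove[of UNIV i] mult.assoc[symmetric])

lemma poly_fun_mult_affine:
  assumes "poly_fun r g"
  shows "poly_fun (Suc r) (\<lambda>v. ((\<Sum>i\<in>UNIV. v $ i * a i) + c) * g v)"
  using assms
proof induction
  case zero
  then show ?case by (simp add: poly_fun.zero)
next
  case (add g m d)
  let ?h = "\<lambda>v. ((\<Sum>i\<in>UNIV. v $ i * a i) + c) * g v"
  have "poly_fun (Suc r) (\<lambda>v. (\<Sum>i\<in>UNIV. (a i * d) * monomial (m(i := Suc (m i))) v) +
     ((c * d) * monomial m v + ?h v))"
  proof (rule poly_fun_add_monomials)
    show "poly_fun (Suc r) (\<lambda>v. (c * d) * monomial m v + ?h v)"
      using add by (intro poly_fun.add) auto
    show "(\<Sum>j\<in>UNIV. (m(i := Suc (m i))) j) \<le> Suc r" for i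
    proof -
      have "(\<Sum>j\<in>UNIV. (m(i := Suc (m i))) j) = Suc (\<Sum>j\<in>UNIV. m j)"
        by (simp add: sum.remove[of UNIV i])
      then show ?thesis using add by simp
    qed
  qed simp
  also have "(\<lambda>v. (\<Sum>i\<in>UNIV. (a i * d) * monomial (m(i := Suc (m i))) v) +
     ((c * d) * monomial m v + ?h v)) = (\<lambda>v. ((\<Sum>i\<in>UNIV. v $ i * a i) + c) * (d * monomial m v + g v))"
  proof
    fix v
    have "(\<Sum>i\<in>UNIV. (a i * d) * monomial (m(i := Suc (m i))) v) = (\<Sum>i\<in>UNIV. v $ i * a i) * (d * monomial m v)"
      by (simp add: monomial_mult_coordinate[symmetric] sum_distrib_left sum_distrib_right mult_ac)
    then show "(\<Sum>i\<in>UNIV. (a i * d) * monomial (m(i := Suc (m i))) v) + ((c * d) * monomial m v + ?h v)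
        = ((\<Sum>i\<in>UNIV. v $ i * a i) + c) * (d * monomial m v + g v)"
      by (simp add: algebra_simps)
  qed
  finally show ?case .
qed

text \<open>Counting version of rank-nullity: each of the \<open>CARD('k) ^ CARD('r)\<close> fibres
  of \<open>H\<close> is empty or a translate of the kernel.\<close>

lemma kernel_dim_ge:
  fixes H :: "'k::{field,finite} ^ 'm::finite ^ 'r::finite"
  shows "CARD('m) \<le> CARD('r) + vec.dim {u. H *v u = 0}"
proof -
  interpret V: finite_linear_space "(*s) :: 'k \<Rightarrow> 'k ^ 'm \<Rightarrow> 'k ^ 'm" "CARD('k)"
    by unfold_locales simp
  let ?K = "{u. H *v u = 0}"
  have "vec.subspace ?K"
    by (auto simp: vec.subspace_def matrix_vector_right_distrib vec.scale)
  then have K: "card ?K = CARD('k) ^ vec.dim ?K" by (rule V.card_subspace)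
  have fibre: "card {u \<in> UNIV. H *v u = z} \<le> card ?K" for z
  proof (cases "\<exists>u0. H *v u0 = z")
    case True
    then obtain u0 where u0: "H *v u0 = z" by blast
    show ?thesis
      by (rule card_inj_on_le[of "\<lambda>u. u - u0"]) (auto simp: inj_on_def u0 matrix_vector_mult_diff_distrib)
  qed simp
  have "CARD('k) ^ CARD('m) = CARD('k ^ 'm)" by (simp add: CARD_vec)
  also have "\<dots> = (\<Sum>z\<in>(UNIV :: ('k ^ 'r) set). card {u \<in> UNIV. H *v u = z})"
    by (rule card_eq_sum_fibres) auto
  also have "\<dots> \<le> (\<Sum>z\<in>(UNIV :: ('k ^ 'r) set). card ?K)" by (rule sum_mono) (rule fibre)
  also have "\<dots> = CARD('k) ^ (CARD('r) + vec.dim ?K)" by (simp add: K CARD_vec power_add)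
  finally show ?thesis using V.q_ge_2 by (simp add: power_increasing_iff)
qed

section \<open>Coordinates in the extension field\<close>

locale extension_basis =
  fixes h :: "'k::{field,finite} \<Rightarrow> 'e::{field,finite}" and b :: "'n::finite \<Rightarrow> 'e" and q :: nat
  assumes embedding: "field_embedding h" and basis: "is_basis h b" and q_card: "q = CARD('k)"

sublocale extension_basis \<subseteq> finite_linear_space "ext_scale h" q
  by (intro finite_linear_space.intro vector_space_ext_scale embedding finite_linear_space_axioms.intro q_card)

context extension_basis
begin

lemma h_add: "h (x + y) = h x + h y" and h_mult: "h (x * y) = h x * h y" and h_1: "h 1 = 1"
  using embedding by (auto simp: field_embedding_def)

lemma h_0: "h 0 = 0"
  using h_add[of 0 0] by (metis add_0 add_cancel_right_right)

lemma h_diff: "h (x - y) = h x - h y"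
  using h_add[of "x - y" y] by simp

lemma h_eq_0_iff: "h x = 0 \<longleftrightarrow> x = 0"
proof
  show "x = 0" if "h x = 0"
  proof (rule ccontr)
    assume "x \<noteq> 0"
    then have "h 1 = h x * h (1 / x)" by (simp flip: h_mult)
    then show False using that by (simp add: h_1)
  qed
qed (simp add: h_0)

lemma lform_coords: "lform (\<lambda>y. coords h b y $ i)"
  using basis
  by (simp add: lform_def coords_def is_basis_def representation_add representation_scale)

lemma coords_add: "coords h b (x + y) = coords h b x + coords h b y"
  using lform_add[OF lform_coords] by (simp add: vec_eq_iff)

lemma coords_mult: "coords h b (h c * y) = c *s coords h b y"
  using lform_scale[OF lform_coords] by (simp add: vec_eq_iff ext_scale_def)

lemma coords_0: "coords h b 0 = 0"
  using lform_0[OF lform_coords] by (simp add: vec_eq_iff)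

lemma coords_sum: "coords h b (\<Sum>i\<in>I. g i) = (\<Sum>i\<in>I. coords h b (g i))"
  by (induction I rule: infinite_finite_induct) (auto simp: coords_0 coords_add)

lemma coords_basis: "coords h b (b j) $ i = (if i = j then 1 else 0)"
  using basis by (auto simp: coords_def is_basis_def representation_basis inj_eq)

lemma sum_coords: "(\<Sum>i\<in>UNIV. h (coords h b y $ i) * b i) = y"
proof -
  have "(\<Sum>z\<in>range b. ext_scale h (representation (range b) y z) z) = y"
    using basis by (intro sum_representation_eq) (auto simp: is_basis_def)
  then show ?thesis
    using basis by (simp add: sum.reindex is_basis_def ext_scale_def coords_def)
qed

lemma coords_eq_0_iff: "coords h b y = 0 \<longleftrightarrow> y = 0"
  using sum_coords[of y] coords_0 by (auto simp: h_0)

lemma lform_eq_sum_coords: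
  assumes "lform g"
  shows "g y = (\<Sum>i\<in>UNIV. coords h b y $ i * g (b i))"
proof -
  have "g (\<Sum>i\<in>I. h (a i) * b i) = (\<Sum>i\<in>I. a i * g (b i))" for I a
    using lform_0[OF assms] lform_add[OF assms] lform_scale[OF assms]
    by (induction I rule: infinite_finite_induct) (auto simp: ext_scale_def)
  from this[of "\<lambda>i. coords h b y $ i" UNIV] show ?thesis by (simp add: sum_coords)
qed

lemma prod_forms_poly_fun:
  assumes "list_all aform fs"
  shows "\<exists>g. poly_fun (length fs) g \<and> (\<forall>y. prod_forms fs y = g (coords h b y))"
  using assms
proof (induction fs)
  case Nil
  have "poly_fun 0 (\<lambda>v :: 'k ^ 'n. 1 * monomial (\<lambda>_. 0) v + 0)"
    by (rule poly_fun.add) (auto intro: poly_fun.zero)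
  then show ?case by (auto simp: monomial_def)
next
  case (Cons f fs)
  then obtain g where g: "poly_fun (length fs) g" "\<And>y. prod_forms fs y = g (coords h b y)" by auto
  obtain l c where "lform l" "f = (\<lambda>x. l x + c)" using Cons.prems by (auto simp: aform_def)
  then have "f y = (\<Sum>i\<in>UNIV. coords h b y $ i * l (b i)) + c" for y
    using lform_eq_sum_coords by metis
  then show ?case using poly_fun_mult_affine[OF g(1), of "\<lambda>i. l (b i)" c] g(2) by auto
qed

text \<open>A monomial is a product of coordinate forms, so \<open>dual_mult_prod\<close> gives one
  direction. Conversely, fewer than \<open>r\<close> affine forms multiply to a polynomial in the
  coordinates of degree at most \<open>r - 1\<close>.\<close>

lemma dual_iff_orthogonal_reed_muller:
  assumes "r > 0"
  shows "u \<in> dual r \<longleftrightarrow> (\<forall>g\<in>reed_muller (int r - 1). (\<Sum>y\<in>UNIV. u y * g (coords h b y)) = 0)"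
proof safe
  fix g :: "'k ^ 'n \<Rightarrow> 'k" assume u: "u \<in> dual r" and "g \<in> reed_muller (int r - 1)"
  then obtain p where p: "mv_eval p = g"
    "\<And>m. m \<in> Poly_Mapping.keys p \<Longrightarrow> int (\<Sum>i\<in>UNIV. Poly_Mapping.lookup m i) \<le> int r - 1"
    unfolding reed_muller_iff by blast
  have mono: "(\<Sum>y\<in>UNIV. u y * (\<Prod>i\<in>UNIV. coords h b y $ i ^ Poly_Mapping.lookup m i)) = 0"
    if m: "m \<in> Poly_Mapping.keys p" for m
  proof -
    have "(\<lambda>y. u y * (\<Prod>i\<in>UNIV. coords h b y $ i ^ Poly_Mapping.lookup m i))
        \<in> dual (r - (\<Sum>i\<in>UNIV. Poly_Mapping.lookup m i))"
      by (rule dual_mult_prod) (auto intro: u lform_imp_aform lform_coords)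
    from dualD[OF this, of "[]"] show ?thesis using p(2)[OF m] by simp
  qed
  have "(\<Sum>y\<in>UNIV. u y * g (coords h b y)) = (\<Sum>y\<in>UNIV. \<Sum>m\<in>Poly_Mapping.keys p.
      Poly_Mapping.lookup p m * (u y * (\<Prod>i\<in>UNIV. coords h b y $ i ^ Poly_Mapping.lookup m i)))"
    by (simp add: p(1)[symmetric] mv_eval_def sum_distrib_left mult_ac)
  also have "\<dots> = (\<Sum>m\<in>Poly_Mapping.keys p. Poly_Mapping.lookup p m *
      (\<Sum>y\<in>UNIV. u y * (\<Prod>i\<in>UNIV. coords h b y $ i ^ Poly_Mapping.lookup m i)))"
    by (subst sum.swap) (simp add: sum_distrib_left)
  also have "\<dots> = 0" using mono by simp
  finally show "(\<Sum>y\<in>UNIV. u y * g (coords h b y)) = 0" .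
next
  assume orth: "\<forall>g\<in>reed_muller (int r - 1). (\<Sum>y\<in>UNIV. u y * g (coords h b y)) = 0"
  show "u \<in> dual r"
  proof (rule dualI)
    fix fs assume fs: "list_all aform fs" "length fs < r"
    then obtain g where g: "poly_fun (length fs) g" "\<And>y. prod_forms fs y = g (coords h b y)"
      using prod_forms_poly_fun by blast
    have "g \<in> reed_muller (int r - 1)" using poly_fun_imp_reed_muller[OF g(1)] fs(2) by simp
    then show "(\<Sum>x\<in>UNIV. u x * prod_forms fs x) = 0" using orth by (simp add: g(2))
  qed
qed

section \<open>The code of a function\<close>

text \<open>Ensures that the code is nonzero, as \<open>is_code\<close> demands. There are
  \<open>q ^ (n + 1)\<close> affine functions, and \<open>T\<close> maps them into a field of
  \<open>q ^ n\<close> elements; the difference of two with equal image is the word sought.\<close>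

lemma exists_affine_codeword:
  assumes "1 \<le> s" "s < n" "CARD('e) = q ^ n" "CARD('n) = n" "q > 2"
  shows "\<exists>u\<in>dual (s * (q - 1)). u \<noteq> (\<lambda>_. 0) \<and> (\<Sum>y\<in>UNIV. h (u y) * f y) = 0"
proof -
  define phi where "phi = (\<lambda>(a :: 'k ^ 'n, c) y. (\<Sum>i\<in>UNIV. a $ i * coords h b y $ i) + c)"
  define T where "T p = (\<Sum>y\<in>UNIV. h (phi p y) * f y)" for p
  have "card (range T) \<le> CARD('e)" by (rule card_mono) auto
  also have "\<dots> < q ^ n * q" using \<open>q > 2\<close> assms by simp
  also have "\<dots> = CARD(('k ^ 'n) \<times> 'k)" by (simp add: q_card[symmetric] CARD_vec assms)
  finally have "\<not> inj T" using pigeonhole[of T UNIV] by simp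
  then obtain p p' where pp': "T p = T p'" "p \<noteq> p'" by (auto simp: inj_def)
  define a c where "a = fst p - fst p'" and "c = snd p - snd p'"
  have phi_diff: "phi (a, c) y = phi p y - phi p' y" for y
    by (simp add: phi_def a_def c_def case_prod_beta sum_subtractf left_diff_distrib)
  have "T (a, c) = T p - T p'"
    unfolding T_def phi_diff h_diff by (simp add: left_diff_distrib sum_subtractf)
  then have T0: "T (a, c) = 0" using pp' by simp
  have "phi (a, c) \<noteq> (\<lambda>_. 0)"
  proof
    assume eq: "phi (a, c) = (\<lambda>_. 0)"
    have "c = 0" using fun_cong[OF eq, of 0] by (simp add: phi_def coords_0)
    moreover have "a $ i = 0" for i
      using fun_cong[OF eq, of "b i"] \<open>c = 0\<close> by (simp add: phi_def coords_basis if_distrib cong: if_cong)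
    then have "a = 0" by (simp add: vec_eq_iff)
    ultimately show False using pp'(2) by (simp add: a_def c_def prod_eq_iff)
  qed
  moreover have "phi (a, c) \<in> dual (s * (q - 1))"
  proof (rule dual_antimono)
    have "aform (phi (a, c))"
      unfolding phi_def by (auto intro!: aform_lform lform_sum lform_coords)
    \<comment> \<open>The constant 1 is the indicator of the whole space, a flat of dimension
      \<open>n\<close>; multiplication by an affine form then costs one degree.\<close>
    moreover have "(\<lambda>y. if y - 0 \<in> UNIV then 1 else 0) \<in> dual (n * (q - 1))"
      by (rule flat_in_dual) (simp_all add: assms)
    ultimately have "(\<lambda>y. (if y - 0 \<in> UNIV then 1 else 0) * phi (a, c) y) \<in> dual (n * (q - 1) - 1)"
      by (intro dual_mult)
    then show "phi (a, c) \<in> dual (n * (q - 1) - 1)" by simp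
    obtain k where "n = Suc (s + k)" using \<open>s < n\<close> less_imp_Suc_add by auto
    then have "n * (q - 1) = s * (q - 1) + (q - 1) + k * (q - 1)"
      by (simp add: add_mult_distrib)
    then show "s * (q - 1) \<le> n * (q - 1) - 1" using \<open>q > 2\<close> by linarith
  qed
  ultimately show ?thesis using T0 unfolding T_def by blast
qed

text \<open>Orthogonality to the rows of \<open>A\<close> extends to their span, the Reed-Muller
  code. The lower rows compute the coordinates of one sum in the extension field.\<close>

lemma mem_code_iff:
  fixes x :: "'m::finite \<Rightarrow> 'e" and A :: "'k ^ 'm ^ 'r::finite"
  assumes "bij x" "r > 0"
    and A: "generator_matrix A (reed_muller_code (\<lambda>j. coords h b (x j)) (int r - 1))"
  shows "u \<in> code_of_parity_check (parity_check_matrix h b x A f) \<longleftrightarrow>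
    (\<lambda>y. u $ inv x y) \<in> dual r \<and> (\<Sum>y\<in>UNIV. h (u $ inv x y) * f y) = 0"
proof -
  have inv: "inv x (x j) = j" for j using assms(1) by (simp add: bij_is_inj)
  have reindex: "(\<Sum>j\<in>UNIV. F j) = (\<Sum>y\<in>UNIV. F (inv x y))" for F :: "'m \<Rightarrow> 'z::comm_monoid_add"
    using sum.reindex_bij_betw[OF assms(1), of "\<lambda>y. F (inv x y)"] by (simp add: inv)
  let ?H = "parity_check_matrix h b x A f"
  let ?C = "reed_muller_code (\<lambda>j. coords h b (x j)) (int r - 1)"
  have "?H *v u = 0 \<longleftrightarrow> (\<forall>i. (?H *v u) $ i = 0)" by (simp add: vec_eq_iff)
  also have "\<dots> \<longleftrightarrow> (\<forall>i. (?H *v u) $ Inl i = 0) \<and> (\<forall>i. (?H *v u) $ Inr i = 0)"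
    by (metis sum.exhaust_sel)
  also have "(\<forall>i. (?H *v u) $ Inl i = 0) \<longleftrightarrow> (\<forall>i. (\<Sum>j\<in>UNIV. A $ i $ j * u $ j) = 0)"
    by (simp add: matrix_vector_mult_def parity_check_matrix_def)
  also have "\<dots> \<longleftrightarrow> (\<forall>w\<in>rows A. (\<Sum>j\<in>UNIV. w $ j * u $ j) = 0)"
    by (auto simp: rows_def row_def)
  also have "\<dots> \<longleftrightarrow> (\<forall>w\<in>?C. (\<Sum>j\<in>UNIV. w $ j * u $ j) = 0)"
  proof -
    have span: "vec.span (rows A) = ?C" using A by (simp add: generator_matrix_def)
    have "vec.subspace {w. (\<Sum>j\<in>UNIV. w $ j * u $ j) = 0}"
      by (auto simp: vec.subspace_def algebra_simps sum.distrib simp flip: sum_distrib_left)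
    then show ?thesis
      unfolding span[symmetric]
      using vec.span_minimal[of "rows A" "{w. (\<Sum>j\<in>UNIV. w $ j * u $ j) = 0}"] vec.span_superset[of "rows A"]
      by blast
  qed
  also have "\<dots> \<longleftrightarrow> (\<forall>g\<in>reed_muller (int r - 1). (\<Sum>j\<in>UNIV. g (coords h b (x j)) * u $ j) = 0)"
    by (simp add: reed_muller_code_def)
  also have "\<dots> \<longleftrightarrow> (\<lambda>y. u $ inv x y) \<in> dual r"
    unfolding dual_iff_orthogonal_reed_muller[OF assms(2)]
    by (subst reindex) (simp add: surj_f_inv_f[OF bij_is_surj[OF assms(1)]] mult.commute)
  also have "(\<forall>i. (?H *v u) $ Inr i = 0) \<longleftrightarrow> (\<Sum>y\<in>UNIV. h (u $ inv x y) * f y) = 0"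
  proof -
    have "(\<forall>i. (?H *v u) $ Inr i = 0) \<longleftrightarrow> coords h b (\<Sum>j\<in>UNIV. h (u $ j) * f (x j)) = 0"
      unfolding coords_sum coords_mult
      by (simp add: matrix_vector_mult_def parity_check_matrix_def vec_eq_iff mult.commute)
    also have "\<dots> \<longleftrightarrow> (\<Sum>y\<in>UNIV. h (u $ inv x y) * f y) = 0"
      unfolding coords_eq_0_iff
      by (subst reindex) (simp add: surj_f_inv_f[OF bij_is_surj[OF assms(1)]])
    finally show ?thesis .
  qed
  finally show ?thesis by (simp add: code_of_parity_check_def)
qed

lemma hamming_weight_eq_card_supp:
  assumes "bij x"
  shows "hamming_weight u = card (supp (\<lambda>y. u $ inv x y))"
proof -
  have "{j. u $ j \<noteq> 0} = inv x ` supp (\<lambda>y. u $ inv x y)"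
    using assms by (auto simp: supp_def bij_is_inj intro!: image_eqI[of j _ "x j" for j])
  then show ?thesis
    unfolding hamming_weight_def
    using card_image[OF inj_on_subset[OF bij_is_inj[OF bij_imp_bij_inv[OF assms]]]] by simp
qed

lemma sum_flat:
  fixes p :: 'e
  shows "(\<Sum>y\<in>UNIV. h (if y - p \<in> U then c else 0) * f y) = h c * (\<Sum>y\<in>(\<lambda>v. p + v) ` U. f y)"
proof -
  have "(\<Sum>y\<in>UNIV. h (if y - p \<in> U then c else 0) * f y) = (\<Sum>y\<in>(\<lambda>v. p + v) ` U. h c * f y)"
    by (rule sum.mono_neutral_cong_right) (auto simp: h_0 intro!: image_eqI[of y _ "y - p" for y])
  then show ?thesis by (simp add: sum_distrib_left)
qed

text \<open>A lighter word would be a multiple of the indicator of a flat by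
  \<open>flat_of_small_supp\<close>, and the last hypothesis on \<open>u\<close> would make
  \<open>f\<close> sum to zero over this flat.\<close>

lemma sum_free_imp_large_supp:
  assumes f: "sum_free h (Suc s) f" and "q > 2"
    and u: "u \<in> dual (Suc s * (q - 1))" "u \<noteq> (\<lambda>_. 0)" "(\<Sum>y\<in>UNIV. h (u y) * f y) = 0"
  shows "2 * (q - 1) * q ^ s \<le> card (supp u)"
proof (rule ccontr)
  assume "\<not> 2 * (q - 1) * q ^ s \<le> card (supp u)"
  then have "q * card (supp u) < q * (2 * (q - 1) * q ^ s)" using \<open>q > 2\<close> by simp
  then have "q * card (supp u) < 2 * (q - 1) * q ^ Suc s" by (simp only: power_Suc mult_ac)
  moreover have "supp u \<noteq> {}" using u(2) by (auto simp: supp_def)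
  ultimately obtain p U c where U: "subspace U" "card U = q ^ Suc s" "c \<noteq> 0"
    and eq: "u = (\<lambda>x. if x - p \<in> U then c else 0)"
    using flat_of_small_supp[OF u(1)] \<open>q > 2\<close> by blast
  have "dim U = Suc s" using card_subspace[OF U(1)] U(2) power_inject_exp[of q "dim U" "Suc s"] \<open>q > 2\<close>
    by (simp del: power_Suc)
  then have "affine_subspace_of_dim h (Suc s) ((\<lambda>v. p + v) ` U)"
    using U(1) unfolding affine_subspace_of_dim_def by blast
  then have "(\<Sum>y\<in>(\<lambda>v. p + v) ` U. f y) \<noteq> 0" using f by (simp add: sum_free_def)
  moreover have "h c * (\<Sum>y\<in>(\<lambda>v. p + v) ` U. f y) = 0" using u(3) unfolding eq sum_flat .
  ultimately show False using U(3) h_eq_0_iff by simp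
qed

end

theorem theorem4p6:
  fixes q n s :: nat
    and h :: "'k::{field,finite} \<Rightarrow> 'e::{field,finite}"
    and b :: "'n::finite \<Rightarrow> 'e"
    and x :: "'m::finite \<Rightarrow> 'e"
    and A :: "'k ^ 'm ^ 'r::finite"
    and f :: "'e \<Rightarrow> 'e"
  assumes "primepow q" and "q > 2" and "1 \<le> s" and "s \<le> n - 1"
    and "CARD('k) = q" and "CARD('e) = q ^ n" and "CARD('n) = n"
    and "field_embedding h"
    and "is_basis h b"
    and "bij x"
    and "generator_matrix A (reed_muller_code (\<lambda>j. coords h b (x j)) (int s * (int q - 1) - 1))"
  shows "sum_free h s f \<longleftrightarrow>
    (\<exists>k d. is_code (q ^ n) k d (code_of_parity_check (parity_check_matrix h b x A f)) \<and>
       int k \<ge> int (q ^ n) - int n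
         - int (vec.dim (reed_muller_code (\<lambda>j. coords h b (x j)) (int s * (int q - 1) - 1))) \<and>
       d \<ge> q ^ s + (q - 2) * q ^ (s - 1))"
proof -
  interpret extension_basis h b q
    using assms by unfold_locales simp_all
  let ?RM = "reed_muller_code (\<lambda>j. coords h b (x j)) (int s * (int q - 1) - 1)"
  define H where "H = parity_check_matrix h b x A f"
  let ?C = "code_of_parity_check H"
  obtain s' where s': "s = Suc s'" using \<open>1 \<le> s\<close> by (cases s) auto
  have r: "int s * (int q - 1) - 1 = int (s * (q - 1)) - 1" "s * (q - 1) > 0"
    using \<open>q > 2\<close> \<open>1 \<le> s\<close> by (simp_all add: of_nat_diff)
  note mem = mem_code_iff[OF \<open>bij x\<close> r(2) assms(11)[unfolded r(1)], of _ f, folded H_def]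
  note weight = hamming_weight_eq_card_supp[OF \<open>bij x\<close>]
  have nonzero: "(\<lambda>y. u $ inv x y) = (\<lambda>_. 0) \<longleftrightarrow> u = 0" for u :: "'k ^ 'm"
    using bij_is_surj[OF bij_imp_bij_inv[OF \<open>bij x\<close>]] by (auto simp: fun_eq_iff vec_eq_iff surj_def) metis
  have D: "q ^ s + (q - 2) * q ^ (s - 1) = 2 * (q - 1) * q ^ s'"
  proof -
    have "q ^ s + (q - 2) * q ^ (s - 1) = (q + (q - 2)) * q ^ s'" by (simp only: s' power_Suc add_mult_distrib diff_Suc_1)
    also have "q + (q - 2) = 2 * (q - 1)" using \<open>q > 2\<close> by simp
    finally show ?thesis .
  qed
  have "vec.subspace ?C"
    by (auto simp: code_of_parity_check_def vec.subspace_def matrix_vector_right_distrib vec.scale)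
  have "CARD('m) = q ^ n" using bij_betw_same_card[OF \<open>bij x\<close>] assms(6) by simp
  \<comment> \<open>The rows of \<open>A\<close> form a basis of \<open>?RM\<close>, so
    \<open>H\<close> has \<open>vec.dim ?RM + n\<close> rows.\<close>
  have dim: "int (vec.dim ?C) \<ge> int (q ^ n) - int n - int (vec.dim ?RM)"
  proof -
    have "vec.independent (rows A)" "vec.span (rows A) = ?RM" "inj (\<lambda>i. row i A)"
      using assms(11) by (simp_all add: generator_matrix_def)
    moreover have "rows A = range (\<lambda>i. row i A)" by (auto simp: rows_def)
    ultimately have "vec.dim ?RM = CARD('r)"
      by (metis card_image vec.dim_span_eq_card_independent)
    moreover have "q ^ n \<le> CARD('r + 'n) + vec.dim ?C"
      using kernel_dim_ge[of H] \<open>CARD('m) = q ^ n\<close> by (simp add: code_of_parity_check_def)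
    then have "q ^ n \<le> CARD('r) + n + vec.dim ?C" using \<open>CARD('n) = n\<close> by simp
    ultimately show ?thesis by linarith
  qed
  have "\<exists>u\<in>?C. u \<noteq> 0"
  proof -
    have "s < n" using assms(3,4) by linarith
    then obtain u where u: "u \<in> dual (s * (q - 1))" "u \<noteq> (\<lambda>_. 0)" "(\<Sum>y\<in>UNIV. h (u y) * f y) = 0"
      using exists_affine_codeword[of s n f] assms by blast
    have eq: "(\<lambda>y. (\<chi> j. u (x j)) $ inv x y) = u"
      by (simp add: surj_f_inv_f[OF bij_is_surj[OF \<open>bij x\<close>]])
    have "(\<chi> j. u (x j)) \<in> ?C" using u(1,3) unfolding mem by (simp add: surj_f_inv_f[OF bij_is_surj[OF \<open>bij x\<close>]])
    moreover have "(\<chi> j. u (x j)) \<noteq> 0" using u(2) eq nonzero[of "\<chi> j. u (x j)"] by simp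
    ultimately show ?thesis by blast
  qed
  show ?thesis
    unfolding H_def[symmetric] D
  proof
    assume sf: "sum_free h s f"
    define d where "d = (LEAST d. \<exists>u\<in>?C - {0}. hamming_weight u = d)"
    have ex: "\<exists>d. \<exists>u\<in>?C - {0}. hamming_weight u = d" using \<open>\<exists>u\<in>?C. u \<noteq> 0\<close> by blast
    then have d: "\<exists>u\<in>?C - {0}. hamming_weight u = d" unfolding d_def by (rule LeastI_ex)
    moreover have "d \<le> hamming_weight u" if "u \<in> ?C - {0}" for u
      unfolding d_def using that by (intro Least_le) blast
    ultimately have "is_code (q ^ n) (vec.dim ?C) d ?C"
      using \<open>vec.subspace ?C\<close> \<open>CARD('m) = q ^ n\<close> by (simp add: is_code_def)
    moreover have "2 * (q - 1) * q ^ s' \<le> d"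
    proof -
      obtain u where u: "u \<in> ?C" "u \<noteq> 0" "hamming_weight u = d" using d by blast
      show ?thesis
        unfolding u(3)[symmetric] weight
        using sum_free_imp_large_supp[of s' f "\<lambda>y. u $ inv x y"] u(1,2) sf \<open>q > 2\<close>
        unfolding mem nonzero s' by blast
    qed
    ultimately show "\<exists>k d. is_code (q ^ n) k d ?C \<and>
       int (q ^ n) - int n - int (vec.dim ?RM) \<le> int k \<and> 2 * (q - 1) * q ^ s' \<le> d"
      using dim by blast
  next
    assume "\<exists>k d. is_code (q ^ n) k d ?C \<and>
       int (q ^ n) - int n - int (vec.dim ?RM) \<le> int k \<and> 2 * (q - 1) * q ^ s' \<le> d"
    then have large: "2 * (q - 1) * q ^ s' \<le> hamming_weight u" if "u \<in> ?C" "u \<noteq> 0" for u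
      using that unfolding is_code_def by (meson DiffI order_trans singletonD)
    show "sum_free h s f"
      unfolding sum_free_def
    proof (intro allI impI notI)
      fix S assume "affine_subspace_of_dim h s S" and sum0: "(\<Sum>y\<in>S. f y) = 0"
      then obtain p U where U: "subspace U" "dim U = s" "S = (\<lambda>v. p + v) ` U"
        unfolding affine_subspace_of_dim_def by blast
      have card: "card U = q ^ s" using card_subspace[OF U(1)] U(2) by simp
      \<comment> \<open>The indicator of a flat over which \<open>f\<close> sums to zero is a
        codeword of weight \<open>q * q ^ s'\<close>. This is below
        \<open>2 * (q - 1) * q ^ s'\<close> exactly because \<open>q > 2\<close>.\<close>
      define v where "v y = (if y - p \<in> U then 1 else 0 :: 'k)" for y
      define u where "u = (\<chi> j. v (x j))"
      have u_inv: "(\<lambda>y. u $ inv x y) = v"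
        by (simp add: u_def surj_f_inv_f[OF bij_is_surj[OF \<open>bij x\<close>]])
      have "v \<in> dual (s * (q - 1))" unfolding v_def by (rule flat_in_dual[OF U(1) card])
      moreover have "(\<Sum>y\<in>UNIV. h (v y) * f y) = 0"
        unfolding v_def sum_flat U(3)[symmetric] by (simp add: sum0)
      moreover have "v p = 1" using subspace_0[OF U(1)] by (simp add: v_def)
      ultimately have "u \<in> ?C" "u \<noteq> 0"
        unfolding mem nonzero[symmetric] u_inv fun_cong[OF u_inv] by auto
      then have "2 * (q - 1) * q ^ s' \<le> card (supp v)" using large[of u] by (simp add: weight u_inv)
      also have "supp v = (\<lambda>w. p + w) ` U"
        by (auto simp: supp_def v_def intro!: image_eqI[of y _ "y - p" for y])
      also have "card \<dots> = q * q ^ s'" by (simp add: card_image card s')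
      finally show False using \<open>q > 2\<close> by simp
    qed
  qed
qed

end
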